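(* Let $T$ be a tree with reference vertex $x_0$ and transition weights $q$ as described in the context, and let $E$ be a separable Fréchet space (over $\mathbb{R}$ or $\mathbb{C}$). Then $U_{FM}(T,E)\cup\{0\}$ contains a vector space (a linear subspace of $H_Q(T,E)$) which is dense in $H_Q(T,E)$.
   Context: **Tree.** $T$ is (the vertex set of) a countable connected graph without non-trivial loops (a tree), each vertex having finitely many neighbors (the number of neighbors may vary with the vertex). Write $x\sim y$ when $x,y$ are neighbors. Fix a reference vertex $x_0\in T$. For $y\neq x_0$, the parent $y^-$ is the unique neighbor of $y$ on the geodesic path from $x_0$ to $y$. $T_n$ is the set of vertices at distance $n$ from $x_0$ ($T_0=\{x_0\}$). For $x\in T$, $S(x)$ is the set of neighbors of $x$ other than its parent $x^-$ (for $x=x_0$, all neighbors). It is assumed that $S(x)$ has at least two elements for every $x\in T$. For each $x\in T$ and $y\in S(x)$ a number $q(x,y)>0$ is given, with $\sum_{y\in S(x)}q(x,y)=1$ (and $q(x,x^-)=0$). **Boundary.** $\partial T$ is the set of infinite geodesics $e=\{z_n:n\in\mathbb{N}\}$ with $z_0=x_0$ and $z_{n+1}\in S(z_n)$ for all $n$; here $\mathbb{N}=\{0,1,2,\dots\}$. For $x\in T_n$, $B_x=\{e\in\partial T: x\in e\}$ and $p(B_x)=\prod_{j=0}^{n-1}q(y_j,y_{j+1})$, where $y_0=x_0,y_1,\dots,y_n=x$ is the geodesic path from $x_0$ to $x$. $\mathcal{M}_n$ is the $\sigma$-algebra on $\partial T$ generated by $\{B_x\}_{x\in T_n}$, $\mathcal{M}$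 is the $\sigma$-algebra generated by $\bigcup_n\mathcal{M}_n$, and $\mathbb{P}$ is the unique probability measure on $\mathcal{M}$ with $\mathbb{P}(B_x)=p(B_x)$ for all $x\in T$. **Function spaces.** Let $d$ be the (complete, translation-invariant, compatible) metric of $E$. A function $f:T\to E$ is harmonic if $f(x)=\sum_{y\in S(x)}q(x,y)f(y)$ for every $x\in T$; $H_Q(T,E)\subset E^T$ is the space of harmonic functions, with the product topology (pointwise convergence). $L^0(\partial T,E)$ is the space of $\mathcal{M}$-measurable functions $\partial T\to E$ modulo $\mathbb{P}$-a.e. equality, with the topology of convergence in probability, given by the metric $\widetilde\rho(h_1,h_2)=\int_{\partial T}\frac{d(h_1,h_2)}{1+d(h_1,h_2)}\,d\mathbb{P}$. For $f\in H_Q(T,E)$ and $n\in\mathbb{N}$, $\omega_n(f):\partial T\to E$ is $\omega_n(f)(e)=f(y_n)$, where $\{y_n\}=e\cap T_n$. **Frequent universality.** The lower density of $A\subseteq\mathbb{N}$ is $\underline d(A)=\liminf_{n}\frac{1}{n+1}\mathrm{card}\{m\in A:m\le n\}$. A function $f\in H_Q(T,E)$ is frequently universal if for every non-empty open $V\subset L^0(\partial T,E)$ the set $\{n\in\mathbb{N}:\omega_n(f)\in V\}$ has strictly positive lower density. $U_{FM}(T,E)$ is the set of frequently universal functions in $H_Q(T,E)$. *)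

theory Defs
  imports
    "HOL-Probability.Probability"
    "HOL-Library.Function_Algebras"
begin

section \<open>Trees\<close>

definition walk :: "('v \<Rightarrow> 'v \<Rightarrow> bool) \<Rightarrow> 'v \<Rightarrow> 'v \<Rightarrow> 'v list \<Rightarrow> bool" where
  "walk adj x y xs \<longleftrightarrow> xs \<noteq> [] \<and> hd xs = x \<and> last xs = y \<and> successively adj xs"

text \<open>The vertex set is the whole (countable) type.  A cycle has at least three vertices; closed
  walks of the form x, y, x are the trivial loops.\<close>

locale rooted_tree =
  fixes adj :: "'v::countable \<Rightarrow> 'v \<Rightarrow> bool" and x0 :: 'v
  assumes adj_sym: "adj x y \<Longrightarrow> adj y x"
    and adj_irrefl: "\<not> adj x x"
    and adj_connected: "\<exists>xs. walk adj x y xs"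
    and adj_acyclic: "\<not> (\<exists>xs. length xs \<ge> 3 \<and> distinct xs \<and> successively adj xs \<and> adj (last xs) (hd xs))"
    and locally_finite: "finite {y. adj x y}"
begin

definition gdist :: "'v \<Rightarrow> 'v \<Rightarrow> nat" where
  "gdist x y = (LEAST n. \<exists>xs. walk adj x y xs \<and> length xs = Suc n)"

definition geodesic :: "'v \<Rightarrow> 'v \<Rightarrow> 'v list" where
  "geodesic x y = (THE xs. walk adj x y xs \<and> length xs = Suc (gdist x y))"

definition level :: "nat \<Rightarrow> 'v set" where
  "level n = {x. gdist x0 x = n}"

definition parent :: "'v \<Rightarrow> 'v" where
  "parent y = (THE z. adj y z \<and> z \<in> set (geodesic x0 y))"

definition succs :: "'v \<Rightarrow> 'v set" where
  "succs x = (if x = x0 then {y. adj x y} else {y. adj x y \<and> y \<noteq> parent x})"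

text \<open>An infinite geodesic is represented by the sequence of its vertices starting at the root, so
  that its only vertex in \<open>level n\<close> is \<open>e n\<close>.\<close>

definition boundary :: "(nat \<Rightarrow> 'v) set" where
  "boundary = {e. e 0 = x0 \<and> (\<forall>n. e (Suc n) \<in> succs (e n))}"

definition cyl :: "'v \<Rightarrow> (nat \<Rightarrow> 'v) set" where
  "cyl x = {e \<in> boundary. x \<in> range e}"

definition level_algebra :: "nat \<Rightarrow> (nat \<Rightarrow> 'v) measure" where
  "level_algebra n = sigma boundary (cyl ` level n)"

definition boundary_algebra :: "(nat \<Rightarrow> 'v) measure" where
  "boundary_algebra = sigma boundary (\<Union>n. sets (level_algebra n))"

end

locale weighted_tree = rooted_tree adj x0
  for adj :: "'v::countable \<Rightarrow> 'v \<Rightarrow> bool" and x0 :: 'v +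
  fixes q :: "'v \<Rightarrow> 'v \<Rightarrow> real"
  assumes two_succs: "card (succs x) \<ge> 2"
    and q_pos: "y \<in> succs x \<Longrightarrow> q x y > 0"
    and q_sum: "(\<Sum>y\<in>succs x. q x y) = 1"
    and q_parent: "x \<noteq> x0 \<Longrightarrow> q x (parent x) = 0"
begin

definition cyl_prob :: "'v \<Rightarrow> real" where
  "cyl_prob x = (\<Prod>j<gdist x0 x. q (geodesic x0 x ! j) (geodesic x0 x ! Suc j))"

definition boundary_measure :: "(nat \<Rightarrow> 'v) measure" where
  "boundary_measure = (THE P. prob_space P \<and> sets P = sets boundary_algebra \<and>
     (\<forall>x. measure P (cyl x) = cyl_prob x))"

end


section \<open>Separable Frechet spaces\<close>

text \<open>Up to isometric isomorphism the scalar fields of sort \<open>{real_normed_field, heine_borel}\<close> are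
  exactly the real and the complex numbers: the Heine-Borel property forces finite dimension over
  the reals.  Completeness and separability of the metric are part of \<open>polish_space\<close>; the metric of
  the type is the fixed translation-invariant one.\<close>

locale separable_frechet_space = vector_space smul
  for smul :: "'k::{real_normed_field,heine_borel} \<Rightarrow> 'e::{ab_group_add,polish_space} \<Rightarrow> 'e" +
  assumes dist_translate: "dist ((x :: 'e) + z) (y + z) = dist x y"
    and continuous_scale: "continuous_on UNIV (\<lambda>(c, x). smul c x)"
    and locally_convex: "open U \<Longrightarrow> 0 \<in> U \<Longrightarrow>
      \<exists>V. open V \<and> 0 \<in> V \<and> V \<subseteq> U \<and>
        (\<forall>x\<in>V. \<forall>y\<in>V. \<forall>t\<in>{0..1}. smul (of_real (1 - t)) x + smul (of_real t) y \<in> V)"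


section \<open>Convergence in probability\<close>

text \<open>The elements of \<open>L0_space P\<close> are the classes of measurable functions modulo equality almost
  everywhere.  Members of a class may differ arbitrarily outside \<open>space P\<close>.\<close>

definition ae_rel ::
  "'a measure \<Rightarrow> (('a \<Rightarrow> 'e::topological_space) \<times> ('a \<Rightarrow> 'e)) set" where
  "ae_rel P = {(g, h). g \<in> borel_measurable P \<and> h \<in> borel_measurable P \<and> (AE e in P. g e = h e)}"

definition ae_class :: "'a measure \<Rightarrow> ('a \<Rightarrow> 'e::topological_space) \<Rightarrow> ('a \<Rightarrow> 'e) set" where
  "ae_class P g = ae_rel P `` {g}"

definition L0_space :: "'a measure \<Rightarrow> ('a \<Rightarrow> 'e::topological_space) set set" where
  "L0_space P = borel_measurable P // ae_rel P"

definition L0_dist ::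
  "'a measure \<Rightarrow> ('a \<Rightarrow> 'e::metric_space) set \<Rightarrow> ('a \<Rightarrow> 'e) set \<Rightarrow> real" where
  "L0_dist P A B = (let g = (SOME g. g \<in> A); h = (SOME h. h \<in> B) in
     (\<integral>e. dist (g e) (h e) / (1 + dist (g e) (h e)) \<partial>P))"

definition L0_topology :: "'a measure \<Rightarrow> ('a \<Rightarrow> 'e::metric_space) set topology" where
  "L0_topology P = Metric_space.mtopology (L0_space P) (L0_dist P)"


section \<open>Frequently universal harmonic functions\<close>

definition lower_density :: "nat set \<Rightarrow> ereal" where
  "lower_density A = liminf (\<lambda>n. ereal (real (card {m \<in> A. m \<le> n}) / real (n + 1)))"

context weighted_tree
begin

definition harmonic_functions ::
  "('k::real_normed_field \<Rightarrow> 'e::ab_group_add \<Rightarrow> 'e) \<Rightarrow> ('v \<Rightarrow> 'e) set" where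
  "harmonic_functions smul = {f. \<forall>x. f x = (\<Sum>y\<in>succs x. smul (of_real (q x y)) (f y))}"

definition \<omega> :: "nat \<Rightarrow> ('v \<Rightarrow> 'e) \<Rightarrow> (nat \<Rightarrow> 'v) \<Rightarrow> 'e" where
  "\<omega> n f = (\<lambda>e. f (e n))"

definition freq_universal ::
  "('k::real_normed_field \<Rightarrow> 'e::{ab_group_add,metric_space} \<Rightarrow> 'e) \<Rightarrow> ('v \<Rightarrow> 'e) set" where
  "freq_universal smul = {f \<in> harmonic_functions smul.
     \<forall>V. openin (L0_topology boundary_measure) V \<longrightarrow> V \<noteq> {} \<longrightarrow>
       lower_density {n. ae_class boundary_measure (\<omega> n f) \<in> V} > 0}"

end

end

theory Submission
  imports Defs
begin

text \<open>
  From a vertex \<open>x\<close> move to a successor \<open>light x\<close> of weight at most 1/2.  If \<open>G\<close> is harmonic, a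
  harmonic \<open>f\<close> can be continued to the successors of \<open>x\<close> by \<open>G\<close>, except at \<open>light x\<close>, where the
  difference \<open>f x - G x\<close> is compensated.  After \<open>k\<close> such steps \<open>f\<close> and \<open>G\<close> agree up to probability
  \<open>2 ^ -k\<close>.  Switching between countably many targets \<open>G\<close> according to the binary ruler sequence,
  the \<open>j\<close>-th one being followed for \<open>j + 1\<close> steps, every target is attained at a set of times of
  positive lower density.  The targets are harmonic functions that are eventually constant along
  paths; they are dense in the harmonic functions, and their boundary values are dense for convergence in
  probability.  Steering countably many functions simultaneously, with at most one nonzero target
  at each time, makes all their nontrivial linear combinations frequently universal.
\<close>

section \<open>Trees\<close>

lemma walk_singleton: "walk adj x x [x]"
  by (simp add: walk_def)

lemma walk_snoc: "walk adj x y xs \<Longrightarrow> adj y z \<Longrightarrow> walk adj x z (xs @ [z])"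
  by (auto simp: walk_def successively_append_iff)

lemma walk_butlast:
  assumes "walk adj x y xs" "length xs \<ge> 2"
  obtains z where "walk adj x z (butlast xs)" "adj z y" "xs = butlast xs @ [y]"
proof -
  have eq: "xs = butlast xs @ [y]" and ne: "butlast xs \<noteq> []"
    using assms by (auto simp: walk_def append_butlast_last_id simp flip: length_0_conv)
  have "successively adj (butlast xs @ [y])"
    using assms(1) eq by (simp add: walk_def)
  then have "successively adj (butlast xs)" "adj (last (butlast xs)) y"
    using ne by (auto simp: successively_append_iff)
  moreover have "hd (butlast xs) = x"
    using assms(1) eq ne by (metis hd_append2 walk_def)
  ultimately show thesis
    using that[of "last (butlast xs)"] eq ne by (simp add: walk_def)
qed

context rooted_tree
begin

section \<open>Depth and uniqueness of shortest walks\<close>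

abbreviation depth :: "'v \<Rightarrow> nat" where "depth \<equiv> gdist x0"

lemma shortest_walk: "\<exists>xs. walk adj x y xs \<and> length xs = Suc (gdist x y)"
proof -
  obtain xs where xs: "walk adj x y xs" using adj_connected by blast
  then have "length xs = Suc (length xs - 1)" by (cases xs) (auto simp: walk_def)
  with xs have "\<exists>n xs. walk adj x y xs \<and> length xs = Suc n" by blast
  then show ?thesis unfolding gdist_def by (rule LeastI_ex)
qed

lemma gdist_le: "walk adj x y xs \<Longrightarrow> length xs = Suc n \<Longrightarrow> gdist x y \<le> n"
  unfolding gdist_def by (rule Least_le) blast

lemma depth_root [simp]: "depth x0 = 0"
  using gdist_le[OF walk_singleton, of x0 0] by simp

lemma depth_eq_0_iff [simp]: "depth x = 0 \<longleftrightarrow> x = x0"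
  using shortest_walk[of x0 x] by (auto simp: walk_def length_Suc_conv)

lemma depth_adj: "adj x y \<Longrightarrow> depth y \<le> Suc (depth x)"
  using shortest_walk[of x0 x] gdist_le[OF walk_snoc] by fastforce

text \<open>Dropping the last vertex of a shortest walk leaves a walk that bounds the depth of
  \<open>z\<close> from above; the edge to \<open>y\<close> bounds it from below.\<close>

lemma walk_predecessor:
  assumes "walk adj x0 y xs" "length xs = Suc (depth y)" "depth y = Suc n"
  obtains z where "walk adj x0 z (butlast xs)" "adj z y" "depth z = n" "xs = butlast xs @ [y]"
proof -
  obtain z where z: "walk adj x0 z (butlast xs)" "adj z y" "xs = butlast xs @ [y]"
    using walk_butlast[OF assms(1)] assms(2,3) by auto
  have "depth z \<le> n" using gdist_le[OF z(1)] assms by simp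
  with depth_adj[OF z(2)] assms have "depth z = n" by simp
  with z that show thesis by blast
qed

lemma predecessor_exists:
  assumes "depth y = Suc n"
  obtains z where "adj z y" "depth z = n"
  using shortest_walk[of x0 y] walk_predecessor assms by metis

text \<open>Descend from two vertices of equal depth until the descending paths meet.\<close>

lemma path_below:
  assumes "depth u = n" "depth v = n" "u \<noteq> v"
  shows "\<exists>xs. length xs \<ge> 3 \<and> distinct xs \<and> successively adj xs \<and> hd xs = u \<and> last xs = v \<and>
    (\<forall>x\<in>set xs. depth x \<le> n)"
  using assms
proof (induction n arbitrary: u v)
  case (Suc n)
  obtain u' v' where u': "adj u' u" "depth u' = n" and v': "adj v' v" "depth v' = n"
    using predecessor_exists Suc.prems by metis
  show ?case
  proof (cases "u' = v'")
    case True
    have "u \<noteq> u'" "u' \<noteq> v" using Suc.prems(1,2) u'(2) v'(2) True by (metis n_not_Suc_n)+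
    then have "length [u, u', v] \<ge> 3 \<and> distinct [u, u', v] \<and> successively adj [u, u', v] \<and>
        hd [u, u', v] = u \<and> last [u, u', v] = v \<and> (\<forall>x\<in>set [u, u', v]. depth x \<le> Suc n)"
      using True Suc.prems u'(2) v'(1) adj_sym[OF u'(1)] by simp
    then show ?thesis by blast
  next
    case False
    obtain xs where xs: "length xs \<ge> 3" "distinct xs" "successively adj xs" "hd xs = u'"
        "last xs = v'" "\<forall>x\<in>set xs. depth x \<le> n"
      using Suc.IH[OF u'(2) v'(2) False] by blast
    have "xs \<noteq> []" using xs(1) by auto
    moreover have "u \<notin> set xs" "v \<notin> set xs" using xs(6) Suc.prems by auto
    ultimately have "length (u # xs @ [v]) \<ge> 3 \<and> distinct (u # xs @ [v]) \<and>
        successively adj (u # xs @ [v]) \<and> hd (u # xs @ [v]) = u \<and> last (u # xs @ [v]) = v \<and>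
        (\<forall>x\<in>set (u # xs @ [v]). depth x \<le> Suc n)"
      using Suc.prems v'(1) xs adj_sym[OF u'(1)]
      by (simp add: successively_append_iff successively_Cons le_SucI)
    then show ?thesis by blast
  qed
qed auto

text \<open>An edge inside a level would close the path of \<open>path_below\<close> to a
  cycle.\<close>

lemma adj_depth_neq:
  assumes "adj u v" shows "depth u \<noteq> depth v"
proof
  assume "depth u = depth v"
  moreover have "u \<noteq> v" using assms adj_irrefl by blast
  ultimately obtain xs where "length xs \<ge> 3" "distinct xs" "successively adj xs" "hd xs = u"
      "last xs = v"
    using path_below by metis
  then show False using adj_acyclic adj_sym[OF assms] by metis
qed

text \<open>Two distinct predecessors would be joined by a path with no vertex as deep as
  \<open>w\<close>, so adding \<open>w\<close> would close a cycle.\<close>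

lemma predecessor_unique:
  assumes "adj u w" "adj v w" "depth w = Suc (depth u)" "depth w = Suc (depth v)"
  shows "u = v"
proof (rule ccontr)
  assume "u \<noteq> v"
  then obtain xs where xs: "length xs \<ge> 3" "distinct xs" "successively adj xs" "hd xs = u"
      "last xs = v" "\<forall>x\<in>set xs. depth x \<le> depth u"
    using path_below[of u "depth u" v] assms by auto
  have "xs \<noteq> []" using xs(1) by auto
  with xs assms have "length (w # xs) \<ge> 3 \<and> distinct (w # xs) \<and> successively adj (w # xs) \<and>
      adj (last (w # xs)) (hd (w # xs))"
    using adj_sym[OF assms(1)] by (auto simp: successively_Cons)
  then show False using adj_acyclic by blast
qed

lemma shortest_walk_unique:
  assumes "walk adj x0 y xs" "length xs = Suc (depth y)"
    "walk adj x0 y ys" "length ys = Suc (depth y)"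
  shows "xs = ys"
  using assms
proof (induction "depth y" arbitrary: y xs ys)
  case 0
  then show ?case by (auto simp: walk_def length_Suc_conv)
next
  case (Suc n)
  obtain z where z: "walk adj x0 z (butlast xs)" "adj z y" "depth z = n" "xs = butlast xs @ [y]"
    using walk_predecessor[of y xs n] Suc by metis
  obtain z' where z': "walk adj x0 z' (butlast ys)" "adj z' y" "depth z' = n" "ys = butlast ys @ [y]"
    using walk_predecessor[of y ys n] Suc by metis
  have "z = z'" using predecessor_unique z z' Suc(2) by metis
  then have "butlast xs = butlast ys"
    using z(1,3) z'(1) Suc by (intro Suc.hyps(1)) auto
  then show ?case using z(4) z'(4) by simp
qed

section \<open>Geodesics, parents and successors\<close>

lemma geodesic_eq:
  assumes "walk adj x0 y xs" "length xs = Suc (depth y)"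
  shows "geodesic x0 y = xs"
  unfolding geodesic_def using assms shortest_walk_unique by (intro the_equality) auto

lemma walk_geodesic: "walk adj x0 y (geodesic x0 y)"
  and length_geodesic: "length (geodesic x0 y) = Suc (depth y)"
  using shortest_walk[of x0 y] geodesic_eq by metis+

lemma geodesic_root: "geodesic x0 x0 = [x0]"
  by (rule geodesic_eq[OF walk_singleton]) simp

lemma geodesic_snoc:
  assumes "adj x y" "depth y = Suc (depth x)"
  shows "geodesic x0 y = geodesic x0 x @ [y]"
  using assms walk_snoc[OF walk_geodesic assms(1)] length_geodesic by (intro geodesic_eq) auto

lemma depth_geodesic: "x \<in> set (geodesic x0 y) \<Longrightarrow> depth x \<le> depth y"
proof (induction "depth y" arbitrary: y)
  case 0
  then show ?case using geodesic_root depth_eq_0_iff[of y] by auto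
next
  case (Suc n)
  obtain z where "adj z y" "depth z = n" using predecessor_exists Suc(2) by metis
  then show ?case using Suc geodesic_snoc[of z y] by fastforce
qed

text \<open>A neighbor of \<open>y\<close> on the geodesic to \<open>y\<close> is not
  \<open>y\<close> itself, hence lies no deeper than \<open>x\<close>; being adjacent to
  \<open>y\<close>, it is a predecessor of \<open>y\<close>, and predecessors are unique.\<close>

lemma parent_eqI:
  assumes "adj x y" "depth y = Suc (depth x)"
  shows "parent y = x"
  unfolding parent_def
proof (rule the_equality)
  have "x \<in> set (geodesic x0 x)"
    using walk_geodesic[of x] last_in_set by (fastforce simp: walk_def)
  then show "adj y x \<and> x \<in> set (geodesic x0 y)"
    using assms(1) adj_sym[OF assms(1)] geodesic_snoc[OF assms] by auto
next
  fix z assume z: "adj y z \<and> z \<in> set (geodesic x0 y)"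
  then have "z \<noteq> y" using adj_irrefl by blast
  then have "depth z \<le> depth x" using z depth_geodesic geodesic_snoc[OF assms] by auto
  moreover have "depth y \<le> Suc (depth z)" using z depth_adj[of z y] adj_sym[of y z] by blast
  ultimately have "depth y = Suc (depth z)" using assms(2) by linarith
  then show "z = x" using predecessor_unique[of z y x] z assms adj_sym[of y z] by blast
qed

text \<open>Edges join consecutive levels, and the only neighbor closer to the root is the parent;
  the case distinction at the root thus disappears.\<close>

lemma succs_iff: "y \<in> succs x \<longleftrightarrow> adj x y \<and> depth y = Suc (depth x)"
proof
  assume y: "y \<in> succs x"
  then have "adj x y" by (auto simp: succs_def split: if_splits)
  moreover have "depth y = Suc (depth x)"
  proof (rule ccontr)
    assume "depth y \<noteq> Suc (depth x)"
    with \<open>adj x y\<close> have *: "depth x = Suc (depth y)"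
      using depth_adj[of x y] depth_adj[of y x] adj_sym[of x y] adj_depth_neq[of x y] by linarith
    have "parent x = y" by (rule parent_eqI[OF adj_sym[OF \<open>adj x y\<close>] *])
    moreover have "x \<noteq> x0" using * by auto
    ultimately show False using y by (auto simp: succs_def)
  qed
  ultimately show "adj x y \<and> depth y = Suc (depth x)" by blast
next
  assume y: "adj x y \<and> depth y = Suc (depth x)"
  moreover have "y \<noteq> parent x" if "x \<noteq> x0"
  proof -
    obtain n where n: "depth x = Suc n"
      using \<open>x \<noteq> x0\<close> depth_eq_0_iff[of x] by (metis not0_implies_Suc)
    obtain z where "adj z x" "depth z = n" using predecessor_exists[OF n] by blast
    then have "parent x = z" using n by (intro parent_eqI) auto
    then show ?thesis using \<open>depth z = n\<close> n y by auto
  qed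
  ultimately show "y \<in> succs x" by (auto simp: succs_def)
qed

lemma parent_succ: "y \<in> succs x \<Longrightarrow> parent y = x"
  by (simp add: succs_iff parent_eqI)

lemma depth_succ: "y \<in> succs x \<Longrightarrow> depth y = Suc (depth x)"
  by (simp add: succs_iff)

lemma finite_succs: "finite (succs x)"
  using locally_finite[of x] by (rule rev_finite_subset) (auto simp: succs_iff)

lemma succ_parent: "y \<noteq> x0 \<Longrightarrow> y \<in> succs (parent y)"
  by (metis depth_eq_0_iff not0_implies_Suc predecessor_exists succs_iff parent_eqI)

lemma vertex_induct [case_names root succ]:
  assumes "P x0" "\<And>x y. P x \<Longrightarrow> y \<in> succs x \<Longrightarrow> P y"
  shows "P x"
proof (induction "depth x" arbitrary: x)
  case 0
  then show ?case using assms(1) by simp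
next
  case (Suc n)
  then have x: "x \<in> succs (parent x)" using succ_parent[of x] depth_eq_0_iff[of x] by force
  then have "n = depth (parent x)" using Suc(2) depth_succ[OF x] by simp
  then show ?case using Suc(1) assms(2) x by blast
qed

section \<open>Levels, boundary and cylinders\<close>

lemma level_0: "level 0 = {x0}"
  by (auto simp: level_def)

lemma level_Suc: "level (Suc n) = (\<Union>x\<in>level n. succs x)"
proof (intro equalityI subsetI)
  fix y assume "y \<in> level (Suc n)"
  then have n: "depth y = Suc n" by (simp add: level_def)
  then have y: "y \<in> succs (parent y)" using succ_parent[of y] depth_eq_0_iff[of y] by force
  then have "parent y \<in> level n" using depth_succ[OF y] n by (simp add: level_def)
  with y show "y \<in> (\<Union>x\<in>level n. succs x)" by blast
qed (auto simp: level_def depth_succ)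

lemma finite_level: "finite (level n)"
  by (induction n) (auto simp: level_0 level_Suc finite_succs)

lemma boundaryD:
  assumes "e \<in> boundary"
  shows "e 0 = x0" "e (Suc n) \<in> succs (e n)"
  using assms by (auto simp: boundary_def)

lemma depth_boundary [simp]: "e \<in> boundary \<Longrightarrow> depth (e n) = n"
  by (induction n) (auto simp: boundaryD depth_succ[OF boundaryD(2)])

lemma parent_boundary: "e \<in> boundary \<Longrightarrow> parent (e (Suc n)) = e n"
  by (rule parent_succ[OF boundaryD(2)])

lemma parent_funpow_boundary: "e \<in> boundary \<Longrightarrow> (parent ^^ k) (e (n + k)) = e n"
  by (induction k) (simp_all add: parent_boundary funpow_swap1)

lemma cyl_eq: "cyl x = {e \<in> boundary. e (depth x) = x}"
  by (auto simp: cyl_def) (metis rangeI)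

text \<open>Cylinders are nested or disjoint: a common geodesic makes the shallower vertex an
  iterated parent of the deeper one, and then every geodesic through the deeper one passes through
  it.\<close>

lemma cyl_inter: "cyl x \<inter> cyl y \<in> {cyl x, cyl y, {}}"
proof -
  have *: "cyl x \<subseteq> cyl z" if "e \<in> cyl x" "e \<in> cyl z" "depth z \<le> depth x" for e x z
  proof
    fix e' assume e': "e' \<in> cyl x"
    let ?k = "depth x - depth z"
    have "(parent ^^ ?k) x = z"
      using that parent_funpow_boundary[of e ?k "depth z"] by (simp add: cyl_eq)
    then show "e' \<in> cyl z"
      using e' that(3) parent_funpow_boundary[of e' ?k "depth z"] by (simp add: cyl_eq)
  qed
  show ?thesis
  proof (cases "cyl x \<inter> cyl y = {}")
    case False
    then obtain e where "e \<in> cyl x" "e \<in> cyl y" by auto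
    then show ?thesis using *[of e x y] *[of e y x] by (cases "depth y \<le> depth x") auto
  qed auto
qed

text \<open>The two stages of generation collapse to one, since each cylinder belongs to the algebra
  of its level.\<close>

lemma sets_boundary_algebra: "sets boundary_algebra = sigma_sets boundary (range cyl)"
  and space_boundary_algebra: "space boundary_algebra = boundary"
proof -
  have sub: "cyl ` A \<subseteq> Pow boundary" for A by (auto simp: cyl_def)
  have sl: "sets (level_algebra n) = sigma_sets boundary (cyl ` level n)" for n
    unfolding level_algebra_def using sub by (rule sets_measure_of)
  have sub2: "(\<Union>n. sets (level_algebra n)) \<subseteq> Pow boundary"
    using sigma_sets_into_sp[OF sub] by (auto simp: sl)
  show "space boundary_algebra = boundary"
    unfolding boundary_algebra_def using sub2 by (rule space_measure_of)
  have "sets boundary_algebra = sigma_sets boundary (\<Union>n. sigma_sets boundary (cyl ` level n))"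
    unfolding boundary_algebra_def using sub2 by (simp add: sl)
  also have "\<dots> = sigma_sets boundary (range cyl)"
  proof (rule sigma_sets_eqI)
    fix A assume "A \<in> (\<Union>n. sigma_sets boundary (cyl ` level n))"
    then show "A \<in> sigma_sets boundary (range cyl)"
      using sigma_sets_mono'[of "cyl ` level n" "range cyl" boundary for n] by blast
  next
    fix A assume "A \<in> range cyl"
    then obtain x where "A = cyl x" by auto
    then have "A \<in> sigma_sets boundary (cyl ` level (depth x))"
      by (auto simp: level_def)
    then show "A \<in> sigma_sets boundary (\<Union>n. sigma_sets boundary (cyl ` level n))"
      by blast
  qed
  finally show "sets boundary_algebra = sigma_sets boundary (range cyl)" .
qed

end


section \<open>The boundary measure\<close>

context weighted_tree
begin

lemma succs_nonempty: "succs x \<noteq> {}"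
  using two_succs[of x] by auto

lemma q_nonneg: "y \<in> succs x \<Longrightarrow> q x y \<ge> 0"
  using q_pos less_imp_le by blast

lemma cyl_prob_root: "cyl_prob x0 = 1"
  by (simp add: cyl_prob_def)

lemma cyl_prob_succ:
  assumes "y \<in> succs x"
  shows "cyl_prob y = cyl_prob x * q x y"
proof -
  have g: "geodesic x0 y = geodesic x0 x @ [y]" and d: "depth y = Suc (depth x)"
    using assms geodesic_snoc by (auto simp: succs_iff)
  have "geodesic x0 x ! depth x = x"
    using walk_geodesic[of x] length_geodesic[of x] by (auto simp: walk_def last_conv_nth)
  then show ?thesis
    unfolding cyl_prob_def d g by (simp add: nth_append length_geodesic)
qed

lemma cyl_prob_nonneg: "cyl_prob x \<ge> 0"
  by (induction x rule: vertex_induct) (auto simp: cyl_prob_root cyl_prob_succ q_nonneg)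

definition step_measure :: "'v \<Rightarrow> 'v measure" where
  "step_measure x = point_measure (succs x) (\<lambda>y. ennreal (q x y))"

lemma prob_space_step_measure: "prob_space (step_measure x)"
  unfolding step_measure_def
  by (rule prob_space_point_measure) (auto simp: finite_succs q_nonneg q_sum)

lemma emeasure_step_measure: "y \<in> succs x \<Longrightarrow> emeasure (step_measure x) {y} = ennreal (q x y)"
  unfolding step_measure_def by (subst emeasure_point_measure_finite) (auto simp: finite_succs)

text \<open>Since a path visits a vertex at most once, a random boundary point arises by letting every
  vertex choose one of its successors independently of the other vertices.\<close>

definition choice_measure :: "('v \<Rightarrow> 'v) measure" where
  "choice_measure = PiM UNIV step_measure"

primrec path :: "('v \<Rightarrow> 'v) \<Rightarrow> nat \<Rightarrow> 'v" where
  "path \<sigma> 0 = x0"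
| "path \<sigma> (Suc n) = \<sigma> (path \<sigma> n)"

lemma space_choice_measure: "space choice_measure = PiE UNIV succs"
  by (simp add: choice_measure_def space_PiM step_measure_def space_point_measure)

lemma path_in_boundary: "\<sigma> \<in> space choice_measure \<Longrightarrow> path \<sigma> \<in> boundary"
  by (auto simp: boundary_def space_choice_measure PiE_iff)

lemma measurable_component: "(\<lambda>\<sigma>. \<sigma> x) \<in> choice_measure \<rightarrow>\<^sub>M count_space UNIV"
proof -
  have "(\<lambda>\<sigma>. \<sigma> x) \<in> choice_measure \<rightarrow>\<^sub>M step_measure x"
    unfolding choice_measure_def by measurable
  moreover have "(\<lambda>y. y) \<in> step_measure x \<rightarrow>\<^sub>M count_space UNIV"
    by (simp add: step_measure_def)
  ultimately show ?thesis by (rule measurable_compose)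
qed

lemma measurable_path: "(\<lambda>\<sigma>. path \<sigma> n) \<in> choice_measure \<rightarrow>\<^sub>M count_space UNIV"
proof (induction n)
  case (Suc n)
  show ?case
    \<comment> \<open>The component that is read depends on \<open>\<sigma>\<close>, but through a
      measurable index with countably many values.\<close>
    unfolding path.simps
    by (rule measurable_compose_countable[OF measurable_component Suc])
qed simp

lemma measurable_path_boundary: "path \<in> choice_measure \<rightarrow>\<^sub>M boundary_algebra"
proof (rule measurable_sigma_sets[OF sets_boundary_algebra])
  show "range cyl \<subseteq> Pow boundary" by (auto simp: cyl_def)
  show "path \<in> space choice_measure \<rightarrow> boundary" using path_in_boundary by auto
  fix A assume "A \<in> range cyl"
  then obtain x where "A = cyl x" by auto
  then have "path -` A \<inter> space choice_measure = (\<lambda>\<sigma>. path \<sigma> (depth x)) -` {x} \<inter> space choice_measure"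
    using path_in_boundary by (auto simp: cyl_eq)
  also have "\<dots> \<in> sets choice_measure"
    using measurable_path by (rule measurable_sets) simp
  finally show "path -` A \<inter> space choice_measure \<in> sets choice_measure" .
qed

text \<open>Turns the geodesic list behind \<open>cyl_prob\<close> into a sequence whose vertices
  are told apart by their depths.\<close>

lemma cyl_prob_along_path:
  "\<exists>g. g 0 = x0 \<and> g (depth x) = x \<and> (\<forall>j<depth x. g (Suc j) \<in> succs (g j)) \<and>
     (\<forall>j\<le>depth x. depth (g j) = j) \<and> cyl_prob x = (\<Prod>j<depth x. q (g j) (g (Suc j)))"
proof (induction x rule: vertex_induct)
  case root
  then show ?case by (auto simp: cyl_prob_root)
next
  case (succ x y)
  then obtain g where g: "g 0 = x0" "g (depth x) = x" "\<forall>j<depth x. g (Suc j) \<in> succs (g j)"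
     "\<forall>j\<le>depth x. depth (g j) = j" "cyl_prob x = (\<Prod>j<depth x. q (g j) (g (Suc j)))"
    by blast
  define g' where "g' = g(Suc (depth x) := y)"
  have "cyl_prob y = (\<Prod>j<Suc (depth x). q (g' j) (g' (Suc j)))"
    using g succ(2) by (simp add: cyl_prob_succ g'_def)
  moreover have "depth (g' j) = j" if "j \<le> Suc (depth x)" for j
    using that g(4) depth_succ[OF succ(2)] by (auto simp: g'_def)
  moreover have "g' (Suc j) \<in> succs (g' j)" if "j < Suc (depth x)" for j
    using that g succ(2) by (auto simp: g'_def less_Suc_eq)
  ultimately show ?case
    using g by (intro exI[of _ g']) (auto simp: depth_succ[OF succ(2)] g'_def)
qed

text \<open>To reach \<open>x\<close>, the choices at the vertices before \<open>x\<close> on the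
  geodesic must be the prescribed ones. These vertices are distinct, so the choices are independent
  and the weights multiply.\<close>

lemma emeasure_path:
  "emeasure choice_measure {\<sigma> \<in> space choice_measure. path \<sigma> (depth x) = x} = ennreal (cyl_prob x)"
proof -
  obtain g where g: "g 0 = x0" "g (depth x) = x" "\<And>j. j < depth x \<Longrightarrow> g (Suc j) \<in> succs (g j)"
     "\<And>j. j \<le> depth x \<Longrightarrow> depth (g j) = j" "cyl_prob x = (\<Prod>j<depth x. q (g j) (g (Suc j)))"
    using cyl_prob_along_path[of x] by blast
  interpret prob_space "step_measure v" for v by (rule prob_space_step_measure)
  interpret product_prob_space step_measure UNIV ..
  have inj: "inj_on g {..<depth x}"
    by (rule inj_on_inverseI[where g = depth]) (use g(4) in auto)
  \<comment> \<open>As \<open>depth\<close> inverts \<open>g\<close>, the vertex prescribed at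
    \<open>v\<close> can be written in terms of \<open>v\<close> alone.\<close>
  let ?X = "\<lambda>v. {g (Suc (depth v))}"
  have path_eq: "path \<sigma> (depth x) = x \<longleftrightarrow> (\<forall>j<depth x. \<sigma> (g j) = g (Suc j))"
    if \<sigma>: "\<sigma> \<in> space choice_measure" for \<sigma>
  proof
    assume *: "\<forall>j<depth x. \<sigma> (g j) = g (Suc j)"
    have "j \<le> depth x \<Longrightarrow> path \<sigma> j = g j" for j
      by (induction j) (use g(1) * in auto)
    then show "path \<sigma> (depth x) = x" using g(2) by simp
  next
    assume *: "path \<sigma> (depth x) = x"
    \<comment> \<open>Downward induction from \<open>x\<close>: each vertex of a path determines the
      one before it as its parent.\<close>
    have "path \<sigma> (depth x - k) = g (depth x - k)" if "k \<le> depth x" for k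
      using that
    proof (induction k)
      case (Suc k)
      then have "Suc (depth x - Suc k) = depth x - k" by simp
      then show ?case
        using Suc parent_boundary[OF path_in_boundary[OF \<sigma>], of "depth x - Suc k"]
          parent_succ[OF g(3)[of "depth x - Suc k"]] by simp
    qed (use * g(2) in simp)
    then have "path \<sigma> j = g j" if "j \<le> depth x" for j
      using that by (metis diff_diff_cancel diff_le_self)
    then show "\<forall>j<depth x. \<sigma> (g j) = g (Suc j)"
      by (metis Suc_leI less_imp_le path.simps(2))
  qed
  have "{\<sigma> \<in> space choice_measure. path \<sigma> (depth x) = x} =
      {\<sigma> \<in> space (PiM UNIV step_measure). \<forall>v\<in>g ` {..<depth x}. \<sigma> v \<in> ?X v}"
    using path_eq g(4) by (auto simp flip: choice_measure_def)
  then have "emeasure choice_measure {\<sigma> \<in> space choice_measure. path \<sigma> (depth x) = x} =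
      (\<Prod>v\<in>g ` {..<depth x}. emeasure (step_measure v) (?X v))"
    unfolding choice_measure_def
    using g(3,4) by (simp only:) (rule emeasure_PiM_Collect, auto simp: step_measure_def sets_point_measure)
  also have "\<dots> = (\<Prod>j<depth x. emeasure (step_measure (g j)) {g (Suc j)})"
    using inj g(4) by (simp add: prod.reindex)
  also have "\<dots> = (\<Prod>j<depth x. ennreal (q (g j) (g (Suc j))))"
    using g(3) by (simp add: emeasure_step_measure)
  also have "\<dots> = ennreal (cyl_prob x)"
    unfolding g(5) by (rule prod_ennreal) (use g(3) q_nonneg in auto)
  finally show ?thesis .
qed

text \<open>By \<open>cyl_inter\<close>, the cylinders together with the empty set are stable under
  intersection, and \<open>cyl x0\<close> is the whole boundary.\<close>

lemma boundary_measure_unique: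
  assumes M: "prob_space M" "sets M = sets boundary_algebra" "\<And>x. measure M (cyl x) = cyl_prob x"
    and N: "prob_space N" "sets N = sets boundary_algebra" "\<And>x. measure N (cyl x) = cyl_prob x"
  shows "M = N"
proof -
  interpret M: prob_space M by fact
  interpret N: prob_space N by fact
  have root: "cyl x0 = boundary" by (auto simp: cyl_eq boundary_def)
  show ?thesis
  proof (rule measure_eqI_generator_eq[where E = "insert {} (range cyl)" and \<Omega> = boundary
        and A = "\<lambda>_. boundary"])
    show "Int_stable (insert {} (range cyl))"
      unfolding Int_stable_def using cyl_inter by fastforce
    show "insert {} (range cyl) \<subseteq> Pow boundary" by (auto simp: cyl_def)
    show "emeasure M X = emeasure N X" if "X \<in> insert {} (range cyl)" for X
      using that M(3) N(3) by (auto simp: M.emeasure_eq_measure N.emeasure_eq_measure)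
    have "sigma_sets boundary (insert {} (range cyl)) = sigma_sets boundary (range cyl)"
      by (rule sigma_sets_eqI) (auto intro: sigma_sets.Empty)
    then show "sets M = sigma_sets boundary (insert {} (range cyl))"
      "sets N = sigma_sets boundary (insert {} (range cyl))"
      using M(2) N(2) by (simp_all add: sets_boundary_algebra)
    show "range (\<lambda>_. boundary) \<subseteq> insert {} (range cyl)" using root by auto
    show "(\<Union>i. boundary) = boundary" by simp
    show "emeasure M boundary \<noteq> \<infinity>" by simp
  qed
qed

text \<open>The law of the path under independent choices is the measure sought;
  \<open>boundary_measure_unique\<close> makes the description definite.\<close>

lemma boundary_measure:
  "prob_space boundary_measure \<and> sets boundary_measure = sets boundary_algebra \<and>
     (\<forall>x. measure boundary_measure (cyl x) = cyl_prob x)"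
  unfolding boundary_measure_def
proof (rule theI2)
  interpret prob_space choice_measure
    unfolding choice_measure_def by (rule prob_space_PiM) (rule prob_space_step_measure)
  let ?P = "distr choice_measure boundary_algebra path"
  have "measure ?P (cyl x) = cyl_prob x" for x
  proof -
    have "cyl x \<in> sets boundary_algebra" by (auto simp: sets_boundary_algebra)
    then have "measure ?P (cyl x) = measure choice_measure (path -` cyl x \<inter> space choice_measure)"
      by (rule measure_distr[OF measurable_path_boundary])
    also have "path -` cyl x \<inter> space choice_measure =
        {\<sigma> \<in> space choice_measure. path \<sigma> (depth x) = x}"
      using path_in_boundary by (auto simp: cyl_eq)
    also have "measure choice_measure \<dots> = cyl_prob x"
      using emeasure_path by (simp add: measure_def cyl_prob_nonneg)
    finally show ?thesis .
  qed
  then show P: "prob_space ?P \<and> sets ?P = sets boundary_algebra \<and>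
      (\<forall>x. measure ?P (cyl x) = cyl_prob x)"
    using prob_space_distr[OF measurable_path_boundary] by simp
  fix M
  assume "prob_space M \<and> sets M = sets boundary_algebra \<and> (\<forall>x. measure M (cyl x) = cyl_prob x)"
  with P show "M = ?P" by (intro boundary_measure_unique) auto
qed

lemma measure_cyl: "measure boundary_measure (cyl x) = cyl_prob x"
  and sets_boundary_measure: "sets boundary_measure = sigma_sets boundary (range cyl)"
  using boundary_measure sets_boundary_algebra by auto

lemma space_boundary_measure: "space boundary_measure = boundary"
  using boundary_measure sets_eq_imp_space_eq space_boundary_algebra by blast

lemma cyl_in_sets: "cyl x \<in> sets boundary_measure"
  by (auto simp: sets_boundary_measure)

end

sublocale weighted_tree \<subseteq> boundary: prob_space boundary_measure
  using boundary_measure by blast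

context weighted_tree
begin

lemma measurable_vertex: "(\<lambda>e. e n) \<in> boundary_measure \<rightarrow>\<^sub>M count_space UNIV"
proof (rule measurable_count_space_eq2_countable[THEN iffD2])
  have "(\<lambda>e. e n) -` {x} \<inter> space boundary_measure \<in> sets boundary_measure" for x
  proof (cases "depth x = n")
    case True
    then have "(\<lambda>e. e n) -` {x} \<inter> space boundary_measure = cyl x"
      by (auto simp: cyl_eq space_boundary_measure)
    then show ?thesis using cyl_in_sets by simp
  next
    case False
    then have "(\<lambda>e. e n) -` {x} \<inter> space boundary_measure = {}"
      by (auto simp: space_boundary_measure)
    then show ?thesis by (metis sets.empty_sets)
  qed
  then show "(\<lambda>e. e n) \<in> space boundary_measure \<rightarrow> UNIV \<and>
      (\<forall>x\<in>UNIV. (\<lambda>e. e n) -` {x} \<inter> space boundary_measure \<in> sets boundary_measure)"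
    by auto
qed

lemma measurable_vertex_fun: "(\<lambda>e. f (e n)) \<in> boundary_measure \<rightarrow>\<^sub>M borel"
  using measurable_compose[OF measurable_vertex, of f borel n] by simp

lemma vertex_pred_in_sets: "{e \<in> boundary. P (e n)} \<in> sets boundary_measure"
  using measurable_sets[OF measurable_vertex[of n], of "Collect P"]
  by (simp add: space_boundary_measure vimage_def Int_def conj_commute)

lemma sum_cyl_prob_level: "(\<Sum>x\<in>level n. cyl_prob x) = 1"
proof -
  have "boundary = (\<Union>x\<in>level n. cyl x)"
    by (auto simp: cyl_eq level_def)
  moreover have "measure boundary_measure (\<Union>x\<in>level n. cyl x) = (\<Sum>x\<in>level n. cyl_prob x)"
    unfolding measure_cyl[symmetric]
    by (rule boundary.finite_measure_finite_Union[OF finite_level])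
      (use cyl_in_sets in \<open>auto simp: disjoint_family_on_def level_def cyl_eq\<close>)
  ultimately show ?thesis
    using boundary.prob_space space_boundary_measure by simp
qed

section \<open>Light successors and the probability of following them\<close>

lemma light_succ_exists: "\<exists>y\<in>succs x. q x y \<le> 1/2"
proof (rule ccontr)
  assume "\<not> ?thesis"
  then have "(\<Sum>y\<in>succs x. 1/2) < (\<Sum>y\<in>succs x. q x y)"
    using succs_nonempty finite_succs by (intro sum_strict_mono) auto
  then show False using two_succs[of x] q_sum[of x] by simp
qed

definition light :: "'v \<Rightarrow> 'v" where
  "light x = (SOME y. y \<in> succs x \<and> q x y \<le> 1/2)"

lemma light_succ: "light x \<in> succs x" and q_light: "q x (light x) \<le> 1/2"
  using light_succ_exists[of x] unfolding light_def by (metis (mono_tags, lifting) someI_ex)+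

lemma depth_light_funpow: "depth ((light ^^ k) x) = depth x + k"
  by (induction k) (auto simp: depth_succ[OF light_succ])

lemma cyl_prob_light_funpow: "cyl_prob ((light ^^ k) x) \<le> cyl_prob x * (1/2) ^ k"
proof (induction k)
  case (Suc k)
  let ?y = "(light ^^ k) x"
  have "cyl_prob (light ?y) = cyl_prob ?y * q ?y (light ?y)"
    by (rule cyl_prob_succ[OF light_succ])
  also have "\<dots> \<le> (cyl_prob x * (1/2) ^ k) * (1/2)"
    using Suc q_light cyl_prob_nonneg q_nonneg[OF light_succ] by (intro mult_mono) auto
  finally show ?case by simp
qed simp

text \<open>The exceptional event of steering: after \<open>k\<close> steps with a constant target,
  only these paths may have missed it.\<close>

definition light_run :: "nat \<Rightarrow> nat \<Rightarrow> (nat \<Rightarrow> 'v) set" where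
  "light_run n k = {e \<in> boundary. \<forall>i<k. e (n + Suc i) = light (e (n + i))}"

lemma light_run_subset: "light_run n k \<subseteq> (\<Union>x\<in>level n. cyl ((light ^^ k) x))"
proof
  fix e assume e: "e \<in> light_run n k"
  then have b: "e \<in> boundary" by (simp add: light_run_def)
  have "i \<le> k \<Longrightarrow> e (n + i) = (light ^^ i) (e n)" for i
    using e by (induction i) (auto simp: light_run_def)
  then have "e \<in> cyl ((light ^^ k) (e n))"
    using b by (simp add: cyl_eq depth_light_funpow)
  moreover have "e n \<in> level n" using b by (simp add: level_def)
  ultimately show "e \<in> (\<Union>x\<in>level n. cyl ((light ^^ k) x))" by blast
qed

lemma light_run_in_sets: "light_run n k \<in> sets boundary_measure"
proof -
  have "light_run n k = boundary \<inter> (\<Inter>i<k. {e \<in> boundary. e (n + Suc i) = light (e (n + i))})"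
    by (auto simp: light_run_def)
  moreover have "{e \<in> boundary. e (n + Suc i) = light (e (n + i))} \<in> sets boundary_measure" for i
  proof -
    \<comment> \<open>The earlier vertex is the parent of the later one, so the condition concerns a
      single coordinate.\<close>
    have "{e \<in> boundary. e (n + Suc i) = light (e (n + i))} =
        {e \<in> boundary. e (n + Suc i) = light (parent (e (n + Suc i)))}"
      using parent_boundary[where n = "n + i"] by auto metis+
    then show ?thesis using vertex_pred_in_sets by simp
  qed
  moreover have "boundary \<in> sets boundary_measure"
    using sets.top[of boundary_measure] space_boundary_measure by simp
  \<comment> \<open>For \<open>k = 0\<close> the intersection has an empty index set, which
    \<open>sets.finite_INT\<close> excludes.\<close>
  ultimately show ?thesis
    by (cases "k = 0") (auto intro!: sets.Int sets.finite_INT)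
qed

text \<open>From a given vertex only one continuation is a light run, and each of its steps costs a
  factor of at most 1/2; it remains to sum over the vertices of level \<open>n\<close>.\<close>

lemma prob_light_run: "measure boundary_measure (light_run n k) \<le> (1/2) ^ k"
proof -
  have "measure boundary_measure (light_run n k) \<le>
      measure boundary_measure (\<Union>x\<in>level n. cyl ((light ^^ k) x))"
    using light_run_subset finite_level cyl_in_sets
    by (intro boundary.finite_measure_mono sets.finite_UN) auto
  also have "\<dots> \<le> (\<Sum>x\<in>level n. cyl_prob ((light ^^ k) x))"
    using finite_level cyl_in_sets measure_cyl
    by (intro order_trans[OF boundary.finite_measure_subadditive_finite]) auto
  also have "\<dots> \<le> (\<Sum>x\<in>level n. cyl_prob x * (1/2) ^ k)"
    by (intro sum_mono cyl_prob_light_funpow)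
  also have "\<dots> = (1/2) ^ k"
    using sum_cyl_prob_level[of n] by (simp flip: sum_distrib_right)
  finally show ?thesis .
qed

end


section \<open>Convergence in probability\<close>

text \<open>\<open>L0_dist\<close> on representatives, which avoids the choice of members of the
  classes.\<close>

definition prob_dist :: "'a measure \<Rightarrow> ('a \<Rightarrow> 'e::metric_space) \<Rightarrow> ('a \<Rightarrow> 'e) \<Rightarrow> real" where
  "prob_dist P g h = (\<integral>e. dist (g e) (h e) / (1 + dist (g e) (h e)) \<partial>P)"

lemma divide_one_plus_bounds:
  fixes a :: real
  assumes "0 \<le> a"
  shows "a / (1 + a) \<le> 1" "a / (1 + a) \<le> a" "a / (1 + a) = 0 \<longleftrightarrow> a = 0"
proof -
  have "1 + a > 0" using assms by simp
  then show "a / (1 + a) \<le> 1" "a / (1 + a) \<le> a" "a / (1 + a) = 0 \<longleftrightarrow> a = 0"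
    using assms by (auto simp: divide_le_eq distrib_left)
qed

text \<open>The function \<open>t / (1 + t)\<close> is increasing and subadditive on nonnegative
  numbers.\<close>

lemma divide_one_plus_triangle:
  fixes a b c :: real
  assumes "0 \<le> a" "0 \<le> b" "0 \<le> c" "c \<le> a + b"
  shows "c / (1 + c) \<le> a / (1 + a) + b / (1 + b)"
proof -
  have "c / (1 + c) \<le> (a + b) / (1 + (a + b))"
    using assms by (simp add: divide_simps) (simp add: algebra_simps)
  also have "\<dots> = a / (1 + (a + b)) + b / (1 + (a + b))" by (simp add: add_divide_distrib)
  also have "\<dots> \<le> a / (1 + a) + b / (1 + b)"
    using assms by (intro add_mono divide_left_mono mult_pos_pos) auto
  finally show ?thesis .
qed

context prob_space
begin

lemma integrable_bounded_dist:
  fixes g h :: "'a \<Rightarrow> 'e::{metric_space,second_countable_topology}"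
  assumes [measurable]: "g \<in> borel_measurable M" "h \<in> borel_measurable M"
  shows "integrable M (\<lambda>e. dist (g e) (h e) / (1 + dist (g e) (h e)))"
proof (rule integrable_const_bound[where B = 1])
  show "AE e in M. norm (dist (g e) (h e) / (1 + dist (g e) (h e))) \<le> 1"
    by (rule AE_I2) (simp add: divide_one_plus_bounds)
qed measurable

lemma ae_class_mem_iff:
  "g \<in> borel_measurable M \<Longrightarrow> h \<in> ae_class M g \<longleftrightarrow> h \<in> borel_measurable M \<and> (AE e in M. g e = h e)"
  by (auto simp: ae_class_def ae_rel_def)

lemma equiv_ae_rel: "equiv (borel_measurable M) (ae_rel M)"
proof (rule equivI)
  show "refl_on (borel_measurable M) (ae_rel M)" by (auto simp: refl_on_def ae_rel_def)
  show "sym (ae_rel M)" by (auto simp: sym_def ae_rel_def elim: eventually_mono)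
  show "trans (ae_rel M)"
    by (auto simp: trans_def ae_rel_def elim: eventually_elim2)
qed (auto simp: ae_rel_def)

lemma ae_class_eq_iff:
  "g \<in> borel_measurable M \<Longrightarrow> h \<in> borel_measurable M \<Longrightarrow>
    ae_class M g = ae_class M h \<longleftrightarrow> (AE e in M. g e = h e)"
  unfolding ae_class_def by (subst eq_equiv_class_iff[OF equiv_ae_rel]) (auto simp: ae_rel_def)

lemma ae_class_in_L0: "g \<in> borel_measurable M \<Longrightarrow> ae_class M g \<in> L0_space M"
  by (simp add: L0_space_def ae_class_def quotientI)

lemma L0_spaceE:
  assumes "A \<in> L0_space M"
  obtains g where "g \<in> borel_measurable M" "A = ae_class M g"
  using assms unfolding L0_space_def ae_class_def by (rule quotientE)

text \<open>The representatives chosen in \<open>L0_dist\<close> agree almost everywhere with the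
  given ones.\<close>

lemma L0_dist_ae_class:
  fixes g h :: "'a \<Rightarrow> 'e::{metric_space,second_countable_topology}"
  assumes [measurable]: "g \<in> borel_measurable M" "h \<in> borel_measurable M"
  shows "L0_dist M (ae_class M g) (ae_class M h) = prob_dist M g h"
proof -
  define g' h' where "g' = (SOME k. k \<in> ae_class M g)" and "h' = (SOME k. k \<in> ae_class M h)"
  have "g' \<in> ae_class M g" "h' \<in> ae_class M h"
    unfolding g'_def h'_def by (rule someI[of _ g] someI[of _ h], simp add: ae_class_mem_iff)+
  then have [measurable]: "g' \<in> borel_measurable M" "h' \<in> borel_measurable M"
    and ae: "AE e in M. g e = g' e" "AE e in M. h e = h' e"
    by (auto simp: ae_class_mem_iff)
  have "prob_dist M g' h' = prob_dist M g h"
    unfolding prob_dist_def by (rule integral_cong_AE) (use ae in auto)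
  then show ?thesis by (simp add: L0_dist_def prob_dist_def g'_def h'_def)
qed

lemma Metric_space_L0:
  "Metric_space (L0_space M) (L0_dist M :: ('a \<Rightarrow> 'e::{metric_space,second_countable_topology}) set \<Rightarrow> _)"
proof
  fix A B :: "('a \<Rightarrow> 'e) set"
  show "0 \<le> L0_dist M A B" by (simp add: L0_dist_def Let_def)
  show "L0_dist M A B = L0_dist M B A" by (simp add: L0_dist_def Let_def dist_commute)
next
  fix A B :: "('a \<Rightarrow> 'e) set"
  assume "A \<in> L0_space M" "B \<in> L0_space M"
  then obtain g h where gh: "g \<in> borel_measurable M" "A = ae_class M g"
    "h \<in> borel_measurable M" "B = ae_class M h" by (metis L0_spaceE)
  have "L0_dist M A B = 0 \<longleftrightarrow> (AE e in M. dist (g e) (h e) / (1 + dist (g e) (h e)) = 0)"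
    using gh integrable_bounded_dist[of g h]
    by (simp add: L0_dist_ae_class prob_dist_def integral_nonneg_eq_0_iff_AE)
  also have "\<dots> \<longleftrightarrow> (AE e in M. g e = h e)"
    by (simp only: divide_one_plus_bounds(3)[OF zero_le_dist] dist_eq_0_iff)
  also have "\<dots> \<longleftrightarrow> A = B" using gh ae_class_eq_iff by metis
  finally show "L0_dist M A B = 0 \<longleftrightarrow> A = B" .
next
  fix A B C :: "('a \<Rightarrow> 'e) set"
  assume "A \<in> L0_space M" "B \<in> L0_space M" "C \<in> L0_space M"
  then obtain f g h where fgh: "f \<in> borel_measurable M" "A = ae_class M f"
    "g \<in> borel_measurable M" "B = ae_class M g"
    "h \<in> borel_measurable M" "C = ae_class M h" by (metis L0_spaceE)
  have "prob_dist M f h \<le> (\<integral>e. dist (f e) (g e) / (1 + dist (f e) (g e)) +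
      dist (g e) (h e) / (1 + dist (g e) (h e)) \<partial>M)"
    unfolding prob_dist_def using fgh integrable_bounded_dist
    by (intro integral_mono Bochner_Integration.integrable_add divide_one_plus_triangle)
      (auto simp: dist_triangle)
  also have "\<dots> = prob_dist M f g + prob_dist M g h"
    unfolding prob_dist_def using fgh integrable_bounded_dist
    by (intro Bochner_Integration.integral_add) auto
  finally show "L0_dist M A C \<le> L0_dist M A B + L0_dist M B C"
    using fgh by (simp add: L0_dist_ae_class)
qed

text \<open>The integrand is at most 1, which is used on \<open>B\<close>, and at most the distance,
  which is used off \<open>B\<close>.\<close>

lemma prob_dist_le:
  fixes g h :: "'a \<Rightarrow> 'e::{metric_space,second_countable_topology}"
  assumes "g \<in> borel_measurable M" "h \<in> borel_measurable M" "B \<in> sets M" "\<delta> \<ge> 0"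
    and close: "\<And>e. e \<in> space M \<Longrightarrow> e \<notin> B \<Longrightarrow> dist (g e) (h e) \<le> \<delta>"
  shows "prob_dist M g h \<le> \<delta> + prob B"
proof -
  have int: "integrable M (indicator B :: 'a \<Rightarrow> real)"
    using assms(3) by (intro integrable_real_indicator) (auto simp: emeasure_eq_measure)
  have "prob_dist M g h \<le> (\<integral>e. \<delta> + indicator B e \<partial>M)"
    unfolding prob_dist_def
  proof (rule integral_mono)
    show "integrable M (\<lambda>e. \<delta> + indicator B e)"
      using int by (intro Bochner_Integration.integrable_add) auto
    fix e assume e: "e \<in> space M"
    show "dist (g e) (h e) / (1 + dist (g e) (h e)) \<le> \<delta> + indicator B e"
    proof (cases "e \<in> B")
      case True
      have "dist (g e) (h e) / (1 + dist (g e) (h e)) \<le> 1" by (simp add: divide_one_plus_bounds)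
      then show ?thesis using True assms(4) by simp
    next
      case False
      have "dist (g e) (h e) / (1 + dist (g e) (h e)) \<le> dist (g e) (h e)"
        by (simp add: divide_one_plus_bounds)
      then show ?thesis using close[OF e False] False by simp
    qed
  qed (use assms integrable_bounded_dist in auto)
  also have "\<dots> = \<delta> + prob B"
    using assms(3) int by (subst Bochner_Integration.integral_add) (auto simp: prob_space)
  finally show ?thesis .
qed

text \<open>Reduces open sets of classes to balls around a function; later arguments see the
  topology only through this.\<close>

lemma open_L0E:
  fixes V :: "('a \<Rightarrow> 'e::{metric_space,second_countable_topology}) set set"
  assumes "openin (L0_topology M) V" "V \<noteq> {}"
  obtains g \<epsilon> where "g \<in> borel_measurable M" "\<epsilon> > 0"
    "\<And>h. h \<in> borel_measurable M \<Longrightarrow> prob_dist M g h < \<epsilon> \<Longrightarrow> ae_class M h \<in> V"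
proof -
  interpret L0: Metric_space "L0_space M" "L0_dist M :: ('a \<Rightarrow> 'e) set \<Rightarrow> _"
    by (rule Metric_space_L0)
  obtain A where A: "A \<in> V" using assms(2) by auto
  then obtain \<epsilon> where \<epsilon>: "\<epsilon> > 0" "L0.mball A \<epsilon> \<subseteq> V" "A \<in> L0_space M"
    using assms(1) unfolding L0_topology_def L0.openin_mtopology by blast
  obtain g where g: "g \<in> borel_measurable M" "A = ae_class M g" using \<epsilon>(3) by (rule L0_spaceE)
  show thesis
  proof
    fix h :: "'a \<Rightarrow> 'e" assume h: "h \<in> borel_measurable M" "prob_dist M g h < \<epsilon>"
    then have "ae_class M h \<in> L0.mball A \<epsilon>"
      using g \<epsilon>(3) by (simp add: L0_dist_ae_class ae_class_in_L0)
    then show "ae_class M h \<in> V" using \<epsilon>(2) by blast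
  qed (use g \<epsilon> in auto)
qed

lemma UN_lessThan_approx:
  fixes A :: "nat \<Rightarrow> 'a set"
  assumes "\<And>i. A i \<in> sets M" "\<epsilon> > 0"
  obtains N where "prob ((\<Union>i. A i) - (\<Union>i<N. A i)) < \<epsilon>"
proof -
  have "(\<lambda>n. prob (\<Union>i<n. A i)) \<longlonglongrightarrow> prob (\<Union>n. \<Union>i<n. A i)"
    using assms(1) by (intro finite_Lim_measure_incseq) (auto simp: incseq_def intro: less_le_trans)
  also have "(\<Union>n. \<Union>i<n. A i) = (\<Union>i. A i)" by blast
  finally obtain N where N: "\<bar>prob (\<Union>i<N. A i) - prob (\<Union>i. A i)\<bar> < \<epsilon>"
    using assms(2) unfolding LIMSEQ_def dist_real_def by blast
  have "prob ((\<Union>i. A i) - (\<Union>i<N. A i)) = prob (\<Union>i. A i) - prob (\<Union>i<N. A i)"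
    using assms(1) by (intro finite_measure_Diff) auto
  with N have "prob ((\<Union>i. A i) - (\<Union>i<N. A i)) < \<epsilon>" by linarith
  then show thesis by (rule that)
qed

end

context weighted_tree
begin

section \<open>Approximation of measurable functions by functions of one vertex\<close>

lemma level_set_lift:
  assumes "n \<le> m"
  shows "{e \<in> boundary. e n \<in> S} = {e \<in> boundary. e m \<in> {x. (parent ^^ (m - n)) x \<in> S}}"
proof -
  have "(parent ^^ (m - n)) (e m) = e n" if "e \<in> boundary" for e
    using parent_funpow_boundary[OF that, of "m - n" n] assms by simp
  then show ?thesis by auto
qed

text \<open>The sets that can be approximated form a \<sigma>-algebra containing the cylinders.
  Asking for all large \<open>m\<close> lets finitely many sets be approximated on a common
  level.\<close>

lemma approx_by_level_set:
  assumes "A \<in> sets boundary_measure" "\<epsilon> > 0"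
  shows "\<exists>n. \<forall>m\<ge>n. \<exists>S. boundary.prob (sym_diff A {e \<in> boundary. e m \<in> S}) < \<epsilon>"
proof -
  have sub: "range cyl \<subseteq> Pow boundary" by (auto simp: cyl_def)
  \<comment> \<open>An approximation on one level suffices, as it lifts to all deeper
    levels.\<close>
  have suff: "\<exists>n. \<forall>m\<ge>n. \<exists>S. boundary.prob (sym_diff A {e \<in> boundary. e m \<in> S}) < \<epsilon>"
    if "boundary.prob (sym_diff A {e \<in> boundary. e k \<in> R}) < \<epsilon>" for A \<epsilon> k R
  proof (intro exI allI impI)
    fix m assume "m \<ge> k"
    show "boundary.prob (sym_diff A {e \<in> boundary. e m \<in> {x. (parent ^^ (m - k)) x \<in> R}}) < \<epsilon>"
      unfolding level_set_lift[OF \<open>m \<ge> k\<close>, symmetric] by (rule that)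
  qed
  have "A \<in> sigma_sets boundary (range cyl)" using assms(1) by (simp add: sets_boundary_measure)
  then show ?thesis using assms(2)
  proof (induction arbitrary: \<epsilon>)
    case (Basic A)
    then obtain x where "A = cyl x" by auto
    then have "A = {e \<in> boundary. e (depth x) \<in> {x}}" by (auto simp: cyl_eq)
    then have "boundary.prob (sym_diff A {e \<in> boundary. e (depth x) \<in> {x}}) < \<epsilon>"
      using Basic.prems by (simp only: Diff_cancel Un_empty_left measure_empty)
    then show ?case by (rule suff)
  next
    case Empty
    then have "boundary.prob (sym_diff {} {e \<in> boundary. e 0 \<in> {}}) < \<epsilon>" by simp
    then show ?case by (rule suff)
  next
    case (Compl A)
    then obtain n where n: "\<And>m. m \<ge> n \<Longrightarrow>
        \<exists>S. boundary.prob (sym_diff A {e \<in> boundary. e m \<in> S}) < \<epsilon>" by blast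
    have "A \<subseteq> boundary" using sigma_sets_into_sp[OF sub] Compl.hyps by blast
    then have eq: "sym_diff (boundary - A) {e \<in> boundary. e m \<in> - S} =
        sym_diff A {e \<in> boundary. e m \<in> S}" for m S
      by blast
    show ?case
    proof (rule exI[of _ n], intro allI impI)
      fix m assume "m \<ge> n"
      then obtain S where S: "boundary.prob (sym_diff A {e \<in> boundary. e m \<in> S}) < \<epsilon>"
        using n by blast
      show "\<exists>S. boundary.prob (sym_diff (boundary - A) {e \<in> boundary. e m \<in> S}) < \<epsilon>"
        by (rule exI[of _ "- S"]) (unfold eq, rule S)
    qed
  next
    case (Union A)
    have A: "A i \<in> sets boundary_measure" for i using Union.hyps by (simp add: sets_boundary_measure)
    have e2: "\<epsilon> / 2 > 0" using Union.prems by simp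
    obtain N where N: "boundary.prob ((\<Union>i. A i) - (\<Union>i<N. A i)) < \<epsilon> / 2"
      by (rule boundary.UN_lessThan_approx[OF A e2])
    \<comment> \<open>The \<open>N\<close> errors add up to at most \<open>\<epsilon> / 2\<close>;
      \<open>Suc N\<close> keeps the denominator positive.\<close>
    define \<eta> where "\<eta> = \<epsilon> / (2 * Suc N)"
    have "\<eta> > 0" using Union.prems by (simp add: \<eta>_def)
    then have "\<forall>i. \<exists>n. \<forall>m\<ge>n. \<exists>S. boundary.prob (sym_diff (A i) {e \<in> boundary. e m \<in> S}) < \<eta>"
      using Union.IH by blast
    from choice[OF this]
    obtain n where n: "\<And>i m. m \<ge> n i \<Longrightarrow>
        \<exists>S. boundary.prob (sym_diff (A i) {e \<in> boundary. e m \<in> S}) < \<eta>" by blast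
    show ?case
    \<comment> \<open>The sum serves as an upper bound of the finitely many levels.\<close>
    proof (rule exI[of _ "\<Sum>i<N. n i"], intro allI impI)
      fix m assume m: "m \<ge> (\<Sum>i<N. n i)"
      have "m \<ge> n i" if "i < N" for i
        using m member_le_sum[of i "{..<N}" n] that by simp
      then have "\<forall>i. \<exists>S. i < N \<longrightarrow> boundary.prob (sym_diff (A i) {e \<in> boundary. e m \<in> S}) < \<eta>"
        using n by blast
      from choice[OF this] obtain S where S: "\<And>i. i < N \<Longrightarrow>
          boundary.prob (sym_diff (A i) {e \<in> boundary. e m \<in> S i}) < \<eta>" by blast
      let ?D = "\<lambda>i. sym_diff (A i) {e \<in> boundary. e m \<in> S i}"
      have D: "?D i \<in> sets boundary_measure" for i
        using A[of i] vertex_pred_in_sets[of "\<lambda>x. x \<in> S i" m] by blast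
      have R: "(\<Union>i. A i) - (\<Union>i<N. A i) \<in> sets boundary_measure"
        using A by auto
      have "sym_diff (\<Union>i. A i) {e \<in> boundary. e m \<in> (\<Union>i<N. S i)} \<subseteq>
          ((\<Union>i. A i) - (\<Union>i<N. A i)) \<union> (\<Union>i<N. ?D i)" (is "?L \<subseteq> ?R")
        by blast
      then have "boundary.prob ?L \<le> boundary.prob ?R"
        using D R by (intro boundary.finite_measure_mono) auto
      also have "\<dots> \<le> boundary.prob ((\<Union>i. A i) - (\<Union>i<N. A i)) + boundary.prob (\<Union>i<N. ?D i)"
        using D R by (intro measure_Un_le) auto
      also have "boundary.prob (\<Union>i<N. ?D i) \<le> (\<Sum>i<N. boundary.prob (?D i))"
        using D by (intro boundary.finite_measure_subadditive_finite) auto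
      also have "\<dots> \<le> (\<Sum>i<N. \<eta>)" using S by (intro sum_mono less_imp_le) auto
      also have "(\<Sum>i<N. \<eta>) \<le> \<epsilon> / 2"
        using Union.prems by (simp add: \<eta>_def field_simps)
      finally show "\<exists>S. boundary.prob (sym_diff (\<Union>i. A i) {e \<in> boundary. e m \<in> S}) < \<epsilon>"
        using N by (intro exI[of _ "\<Union>i<N. S i"]) linarith
    qed
  qed
qed

text \<open>Up to small probability, finitely many of the sets where \<open>g\<close> is near some
  \<open>d i\<close> cover the boundary; each is replaced by a set decided on a common level
  \<open>m\<close>.\<close>

lemma approx_by_step_function:
  fixes g :: "(nat \<Rightarrow> 'v) \<Rightarrow> 'e::{metric_space,second_countable_topology}" and d :: "nat \<Rightarrow> 'e"
  assumes [measurable]: "g \<in> borel_measurable boundary_measure"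
    and dense: "\<And>x \<delta>. \<delta> > 0 \<Longrightarrow> \<exists>i. dist x (d i) < \<delta>" and "\<delta> > 0"
  obtains m B and \<phi> :: "'v \<Rightarrow> nat" where "B \<in> sets boundary_measure" "boundary.prob B < \<delta>"
    "\<And>e. e \<in> boundary \<Longrightarrow> e \<notin> B \<Longrightarrow> dist (g e) (d (\<phi> (e m))) < \<delta>"
proof -
  define A where "A i = {e \<in> boundary. dist (g e) (d i) < \<delta>}" for i
  have A: "A i \<in> sets boundary_measure" for i
  proof -
    have "{e \<in> space boundary_measure. dist (g e) (d i) < \<delta>} \<in> sets boundary_measure" by measurable
    then show ?thesis by (simp add: A_def space_boundary_measure)
  qed
  have UN: "(\<Union>i. A i) = boundary" using dense[OF \<open>\<delta> > 0\<close>] by (auto simp: A_def)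
  have d2: "\<delta> / 2 > 0" using \<open>\<delta> > 0\<close> by simp
  obtain N where N: "boundary.prob ((\<Union>i. A i) - (\<Union>i<N. A i)) < \<delta> / 2"
    by (rule boundary.UN_lessThan_approx[OF A d2])
  define \<eta> where "\<eta> = \<delta> / (2 * Suc N)"
  have "\<eta> > 0" using \<open>\<delta> > 0\<close> by (simp add: \<eta>_def)
  then have "\<forall>i. \<exists>n. \<forall>m\<ge>n. \<exists>S. boundary.prob (sym_diff (A i) {e \<in> boundary. e m \<in> S}) < \<eta>"
    using approx_by_level_set[OF A] by blast
  from choice[OF this] obtain n where n: "\<And>i m. m \<ge> n i \<Longrightarrow>
      \<exists>S. boundary.prob (sym_diff (A i) {e \<in> boundary. e m \<in> S}) < \<eta>" by blast
  define m where "m = (\<Sum>i<N. n i)"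
  have "m \<ge> n i" if "i < N" for i
    unfolding m_def using member_le_sum[of i "{..<N}" n] that by simp
  then have "\<forall>i. \<exists>S. i < N \<longrightarrow> boundary.prob (sym_diff (A i) {e \<in> boundary. e m \<in> S}) < \<eta>"
    using n by blast
  from choice[OF this] obtain S where S: "\<And>i. i < N \<Longrightarrow>
      boundary.prob (sym_diff (A i) {e \<in> boundary. e m \<in> S i}) < \<eta>" by blast
  let ?D = "\<lambda>i. sym_diff (A i) {e \<in> boundary. e m \<in> S i}"
  have D: "?D i \<in> sets boundary_measure" for i
    using A[of i] vertex_pred_in_sets[of "\<lambda>x. x \<in> S i" m] by blast
  have R: "(\<Union>i. A i) - (\<Union>i<N. A i) \<in> sets boundary_measure"
    using A by auto
  let ?B = "((\<Union>i. A i) - (\<Union>i<N. A i)) \<union> (\<Union>i<N. ?D i)"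
  have "boundary.prob ?B \<le> boundary.prob ((\<Union>i. A i) - (\<Union>i<N. A i)) + boundary.prob (\<Union>i<N. ?D i)"
    using D R by (intro measure_Un_le) auto
  also have "boundary.prob (\<Union>i<N. ?D i) \<le> (\<Sum>i<N. boundary.prob (?D i))"
    using D by (intro boundary.finite_measure_subadditive_finite) auto
  also have "\<dots> \<le> (\<Sum>i<N. \<eta>)" using S by (intro sum_mono less_imp_le) auto
  also have "(\<Sum>i<N. \<eta>) \<le> \<delta> / 2"
    using \<open>\<delta> > 0\<close> by (simp add: \<eta>_def field_simps)
  finally have probB: "boundary.prob ?B < \<delta>" using N by linarith
  \<comment> \<open>The sets may overlap, but any index chosen is good: off the exceptional set,
    \<open>e m\<close> lies in \<open>S i\<close> exactly if \<open>e\<close> lies in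
    \<open>A i\<close>, for each \<open>i < N\<close>.\<close>
  define \<phi> where "\<phi> x = (SOME i. i < N \<and> x \<in> S i)" for x
  show thesis
  proof
    show "?B \<in> sets boundary_measure" using D R by auto
    show "boundary.prob ?B < \<delta>" by (rule probB)
    fix e assume e: "e \<in> boundary" "e \<notin> ?B"
    then obtain i where i: "i < N" "e \<in> A i" using UN by blast
    then have "i < N \<and> e m \<in> S i" using e by blast
    then have "\<phi> (e m) < N \<and> e m \<in> S (\<phi> (e m))" unfolding \<phi>_def by (rule someI)
    then have "e \<in> A (\<phi> (e m))" using e by blast
    then show "dist (g e) (d (\<phi> (e m))) < \<delta>" by (simp add: A_def)
  qed
qed

end


section \<open>Times of positive lower density\<close>

text \<open>All indices below \<open>n div a\<close> give times up to \<open>n\<close>, so at least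
  \<open>n div a - M\<close> elements are counted, and this exceeds a fixed fraction of
  \<open>n\<close> once \<open>n\<close> is large.\<close>

lemma lower_density_pos:
  fixes s :: "nat \<Rightarrow> nat"
  assumes "inj s" "a > 0" "\<And>m. s m \<le> a * Suc m" "\<And>m. m \<ge> M \<Longrightarrow> s m \<in> A"
  shows "lower_density A > 0"
proof -
  have "1 / real (2 * a) \<le> real (card {m \<in> A. m \<le> n}) / real (n + 1)"
    if n: "n \<ge> 2 * a * Suc M + 1" for n
  proof -
    have "s m \<le> n" if "m < n div a" for m
    proof -
      have "s m \<le> a * (n div a)"
        using assms(3)[of m] mult_le_mono2[of "Suc m" "n div a" a] that by linarith
      then show ?thesis using times_div_less_eq_dividend[of a n] by linarith
    qed
    then have "s ` {M..<n div a} \<subseteq> {m \<in> A. m \<le> n}"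
      using assms(4) by auto
    then have "card (s ` {M..<n div a}) \<le> card {m \<in> A. m \<le> n}"
      by (rule card_mono[rotated]) auto
    then have c: "n div a - M \<le> card {m \<in> A. m \<le> n}"
      using assms(1) by (simp add: card_image inj_on_subset)
    have "n < a * Suc (n div a)"
      using dividend_less_times_div[OF \<open>a > 0\<close>, of n] by simp
    moreover have "a * (n div a) \<le> a * (n div a - M) + a * M"
      unfolding add_mult_distrib2[symmetric] by (rule mult_le_mono2) simp
    moreover have "a * (n div a - M) \<le> a * card {m \<in> A. m \<le> n}"
      using c by (rule mult_le_mono2)
    ultimately have "n < a * card {m \<in> A. m \<le> n} + a * Suc M"
      unfolding mult_Suc_right by linarith
    then have "n + 1 \<le> 2 * a * card {m \<in> A. m \<le> n}"
      using n unfolding mult.assoc by linarith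
    then have "real (n + 1) \<le> real (2 * a) * real (card {m \<in> A. m \<le> n})"
      by (metis of_nat_le_iff of_nat_mult)
    then show ?thesis using \<open>a > 0\<close> by (simp add: field_simps)
  qed
  then have "ereal (1 / real (2 * a)) \<le> lower_density A"
    unfolding lower_density_def
    by (intro Liminf_bounded) (auto simp: eventually_sequentially)
  moreover have "0 < ereal (1 / real (2 * a))" using \<open>a > 0\<close> by simp
  ultimately show ?thesis by (rule less_le_trans[rotated])
qed

text \<open>The exponent of 2 in \<open>n\<close>, with value 0 at 0.\<close>

fun ruler :: "nat \<Rightarrow> nat" where
  "ruler n = (if n = 0 \<or> odd n then 0 else Suc (ruler (n div 2)))"

declare ruler.simps [simp del]

lemma ruler_odd: "odd n \<Longrightarrow> ruler n = 0"
  by (subst ruler.simps) simp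

lemma ruler_double: "n > 0 \<Longrightarrow> ruler (2 * n) = Suc (ruler n)"
  by (subst ruler.simps) simp

lemma ruler_pow2: "ruler (2 ^ j * Suc (2 * r)) = j"
proof (induction j)
  case (Suc j)
  have "ruler (2 * (2 ^ j * Suc (2 * r))) = Suc (ruler (2 ^ j * Suc (2 * r)))"
    by (rule ruler_double) simp
  then show ?case by (simp only: power_Suc mult.assoc Suc.IH)
qed (simp add: ruler_odd)

text \<open>Odd indices contribute 0, and each even index contributes one more than its
  half.\<close>

lemma sum_ruler_double: "(\<Sum>i<2 * n. ruler (Suc i)) = (\<Sum>i<n. ruler (Suc i)) + n"
proof (induction n)
  case (Suc n)
  have "ruler (Suc (2 * n)) = 0" by (rule ruler_odd) simp
  moreover have "ruler (Suc (Suc (2 * n))) = Suc (ruler (Suc n))"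
    using ruler_double[of "Suc n"] by simp
  ultimately show ?case using Suc by simp
qed simp

text \<open>Halving the range bounds the average rank by 1, hence the average gap between hitting
  times by 2.\<close>

lemma sum_ruler_le: "(\<Sum>i<n. ruler (Suc i)) \<le> n"
proof (induction n rule: less_induct)
  case (less n)
  show ?case
  proof (cases "n = 0")
    case False
    define k where "k = n div 2"
    have "k < n" using False by (simp add: k_def)
    then have IH: "(\<Sum>i<k. ruler (Suc i)) \<le> k" by (rule less)
    have "n = 2 * k \<or> n = Suc (2 * k)" unfolding k_def by presburger
    then show ?thesis
    proof
      assume "n = Suc (2 * k)"
      moreover have "ruler (Suc (2 * k)) = 0" by (rule ruler_odd) simp
      ultimately show ?thesis using IH by (simp add: sum_ruler_double)
    qed (use IH in \<open>simp add: sum_ruler_double\<close>)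
  qed simp
qed

text \<open>The \<open>i\<close>-th target is to be reached at time \<open>hit i\<close>, after \<open>ruler i + 1\<close> steps.  Targets of
  rank \<open>j\<close> are reached up to probability \<open>2 ^ -(j + 1)\<close>, and yet the times have bounded average gaps.\<close>

definition hit :: "nat \<Rightarrow> nat" where
  "hit n = (\<Sum>i<n. Suc (ruler (Suc i)))"

lemma hit_Suc: "hit (Suc n) = hit n + Suc (ruler (Suc n))"
  by (simp add: hit_def)

lemma strict_mono_hit: "strict_mono hit"
  by (rule strict_monoI_Suc) (simp add: hit_Suc)

lemma hit_le: "hit n \<le> 2 * n"
proof -
  have "hit n = (\<Sum>i<n. ruler (Suc i)) + n" by (induction n) (simp_all add: hit_def)
  then show ?thesis using sum_ruler_le[of n] by simp
qed

text \<open>The hitting times cut the levels into blocks, each ending at a hitting time; this is the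
  index of the block that contains level \<open>n\<close>.\<close>

definition phase :: "nat \<Rightarrow> nat" where
  "phase n = (LEAST i. n \<le> hit i)"

lemma phase_eq:
  assumes "hit i < n" "n \<le> hit (Suc i)"
  shows "phase n = Suc i"
  unfolding phase_def
proof (rule Least_equality)
  fix k assume "n \<le> hit k"
  with assms(1) have "hit i < hit k" by linarith
  then show "Suc i \<le> k" using strict_mono_less[OF strict_mono_hit] Suc_leI by blast
qed (rule assms(2))


section \<open>Steered harmonic functions\<close>

lemma dense_sequence_exists:
  "\<exists>d :: nat \<Rightarrow> 'e::{metric_space,second_countable_topology}. \<forall>U. open U \<longrightarrow> U \<noteq> {} \<longrightarrow> (\<exists>i. d i \<in> U)"
proof -
  obtain D :: "'e set" where D: "countable D" "\<And>U. open U \<Longrightarrow> U \<noteq> {} \<Longrightarrow> \<exists>d\<in>D. d \<in> U"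
    using countable_dense_exists by metis
  then have "D \<noteq> {}" using open_UNIV by blast
  then have "range (from_nat_into D) = D" using D(1) by (rule range_from_nat_into)
  then have "\<forall>U. open U \<longrightarrow> U \<noteq> {} \<longrightarrow> (\<exists>i. from_nat_into D i \<in> U)" using D(2) by (metis rangeE)
  then show ?thesis by blast
qed

definition dense_seq :: "nat \<Rightarrow> 'e::{metric_space,second_countable_topology}" where
  "dense_seq = (SOME d. \<forall>U. open U \<longrightarrow> U \<noteq> {} \<longrightarrow> (\<exists>i. d i \<in> U))"

lemma dense_seq: "open U \<Longrightarrow> U \<noteq> {} \<Longrightarrow> \<exists>i. dense_seq i \<in> U"
  using someI_ex[OF dense_sequence_exists] unfolding dense_seq_def by blast

text \<open>A list encodes a finitely supported function with values in a dense sequence, so that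
  there are countably many of them.\<close>

definition finite_support_fun ::
  "('v \<times> nat) list \<Rightarrow> 'v \<Rightarrow> 'e::{zero,metric_space,second_countable_topology}" where
  "finite_support_fun L x = (case map_of L x of None \<Rightarrow> 0 | Some i \<Rightarrow> dense_seq i)"

lemma finite_support_fun_exists:
  fixes \<phi> :: "'v \<Rightarrow> nat"
  assumes "finite A"
  obtains L where "\<And>x. x \<in> A \<Longrightarrow>
    finite_support_fun L x = (dense_seq (\<phi> x) :: 'e::{zero,metric_space,second_countable_topology})"
proof -
  obtain xs where "set xs = A" using finite_list[OF assms] by blast
  then have "finite_support_fun (map (\<lambda>x. (x, \<phi> x)) xs) x = (dense_seq (\<phi> x) :: 'e)" if "x \<in> A" for x
    using that by (simp add: finite_support_fun_def map_of_map_restrict)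
  then show thesis by (rule that)
qed

lemma open_fun_basis:
  fixes U :: "('v \<Rightarrow> 'e::topological_space) set"
  assumes "open U" "f \<in> U"
  obtains X where "\<And>x. open (X x)" "\<And>x. f x \<in> X x" "finite {x. X x \<noteq> UNIV}"
    "\<And>g. (\<And>x. g x \<in> X x) \<Longrightarrow> g \<in> U"
proof -
  have "openin (product_topology (\<lambda>i. euclidean) UNIV) U"
    using assms(1) by (simp add: open_fun_def)
  from product_topology_open_contains_basis[OF this assms(2)]
  obtain X where X: "f \<in> (\<Pi>\<^sub>E i\<in>UNIV. X i)" "\<And>i. openin euclidean (X i)"
    "finite {i. X i \<noteq> topspace euclidean}" "(\<Pi>\<^sub>E i\<in>UNIV. X i) \<subseteq> U" by blast
  show thesis
    by (rule that[of X]) (use X in \<open>auto simp: PiE_iff\<close>)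
qed

text \<open>A basic open box constrains finitely many coordinates, and only there does the code have
  to choose a value.\<close>

lemma finite_support_fun_dense:
  fixes U :: "('v \<Rightarrow> 'e::{zero,metric_space,second_countable_topology}) set"
  assumes "open U" "f \<in> U"
  shows "\<exists>L. finite_support_fun L \<in> U"
proof -
  obtain X where X: "\<And>x. open (X x)" "\<And>x. f x \<in> X x" "finite {x. X x \<noteq> UNIV}"
    "\<And>g. (\<And>x. g x \<in> X x) \<Longrightarrow> g \<in> U"
    using open_fun_basis[OF assms] by metis
  have "\<forall>x. \<exists>i. dense_seq i \<in> X x" using dense_seq X(1,2) by blast
  from choice[OF this] obtain \<phi> where \<phi>: "\<And>x. dense_seq (\<phi> x) \<in> X x" by blast
  obtain L where L: "\<And>x. x \<in> {x. X x \<noteq> UNIV} \<Longrightarrow> finite_support_fun L x = (dense_seq (\<phi> x) :: 'e)"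
    using finite_support_fun_exists[OF X(3)] by metis
  have "finite_support_fun L x \<in> X x" for x
    using L[of x] \<phi>[of x] by (cases "X x = UNIV") auto
  then show ?thesis using X(4) by blast
qed

locale frechet_tree = weighted_tree adj x0 q + separable_frechet_space smul
  for adj :: "'v::countable \<Rightarrow> 'v \<Rightarrow> bool" and x0 :: 'v and q :: "'v \<Rightarrow> 'v \<Rightarrow> real"
    and smul :: "'k::{real_normed_field,heine_borel} \<Rightarrow> 'e::{ab_group_add,polish_space} \<Rightarrow> 'e"
begin

lemma continuous_on_smul: "continuous_on UNIV (smul c)"
proof -
  have "continuous_on UNIV (\<lambda>x. (c, x))" by (intro continuous_intros)
  from continuous_on_compose2[OF continuous_scale this] show ?thesis by simp
qed

text \<open>Translation invariance bounds the distance of two sums by the sum of the distances of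
  their terms.\<close>

lemma continuous_on_plus:
  fixes f g :: "'a::topological_space \<Rightarrow> 'e"
  assumes "continuous_on S f" "continuous_on S g"
  shows "continuous_on S (\<lambda>x. f x + g x)"
  unfolding continuous_on_def
proof
  fix x assume "x \<in> S"
  then have lim: "((\<lambda>y. dist (f y) (f x)) \<longlongrightarrow> 0) (at x within S)"
    "((\<lambda>y. dist (g y) (g x)) \<longlongrightarrow> 0) (at x within S)"
    using assms by (auto simp: continuous_on_def simp flip: tendsto_dist_iff)
  have "dist (f y + g y) (f x + g x) \<le> dist (f y) (f x) + dist (g y) (g x)" for y
  proof -
    have "dist (f y + g y) (f x + g x) \<le> dist (f y + g y) (f x + g y) + dist (f x + g y) (f x + g x)"
      by (rule dist_triangle)
    then show ?thesis
      using dist_translate[of "f y" "g y" "f x"] dist_translate[of "g y" "f x" "g x"]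
      by (simp add: add.commute)
  qed
  then have "((\<lambda>y. dist (f y + g y) (f x + g x)) \<longlongrightarrow> 0) (at x within S)"
    by (intro tendsto_sandwich[OF _ _ tendsto_const tendsto_add_zero[OF lim]]) auto
  then show "((\<lambda>x. f x + g x) \<longlongrightarrow> f x + g x) (at x within S)"
    by (rule tendsto_dist_iff[THEN iffD2])
qed

lemma continuous_on_sum':
  fixes f :: "'b \<Rightarrow> 'a::topological_space \<Rightarrow> 'e"
  assumes "\<And>i. i \<in> A \<Longrightarrow> continuous_on S (f i)"
  shows "continuous_on S (\<lambda>x. \<Sum>i\<in>A. f i x)"
  using assms by (induction A rule: infinite_finite_induct) (auto intro: continuous_on_plus)

section \<open>Harmonic functions obtained by averaging and freezing\<close>

lemma harmonicD:
  "f \<in> harmonic_functions smul \<Longrightarrow> (\<Sum>y\<in>succs x. smul (of_real (q x y)) (f y)) = f x"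
  unfolding harmonic_functions_def mem_Collect_eq by (drule spec, erule sym)

lemma harmonicI:
  "(\<And>x. (\<Sum>y\<in>succs x. smul (of_real (q x y)) (f y)) = f x) \<Longrightarrow> f \<in> harmonic_functions smul"
  by (simp add: harmonic_functions_def)

text \<open>The expected value of \<open>\<phi>\<close> after \<open>k\<close> steps of the random
  walk with transition weights \<open>q\<close>.\<close>

primrec avg :: "nat \<Rightarrow> ('v \<Rightarrow> 'e) \<Rightarrow> 'v \<Rightarrow> 'e" where
  "avg 0 \<phi> x = \<phi> x"
| "avg (Suc k) \<phi> x = (\<Sum>y\<in>succs x. smul (of_real (q x y)) (avg k \<phi> y))"

text \<open>By truncated subtraction, this averages below level \<open>m\<close> and is constant beyond it.\<close>

definition freeze :: "nat \<Rightarrow> ('v \<Rightarrow> 'e) \<Rightarrow> 'v \<Rightarrow> 'e" where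
  "freeze m \<phi> x = avg (m - depth x) \<phi> ((parent ^^ (depth x - m)) x)"

lemma avg_harmonic: "f \<in> harmonic_functions smul \<Longrightarrow> avg k f x = f x"
  by (induction k arbitrary: x) (simp_all add: harmonicD)

text \<open>At depths less than \<open>m\<close> the recursion of \<open>avg\<close> is harmonicity;
  at all others the successors share the value of their parent, and the weights sum to 1.\<close>

lemma harmonic_freeze: "freeze m \<phi> \<in> harmonic_functions smul"
proof -
  have "freeze m \<phi> x = (\<Sum>y\<in>succs x. smul (of_real (q x y)) (freeze m \<phi> y))" for x
  proof (cases "depth x < m")
    case True
    then have "m - depth x = Suc (m - Suc (depth x))" by simp
    then show ?thesis using True by (simp add: freeze_def depth_succ)
  next
    case False
    then have "freeze m \<phi> y = freeze m \<phi> x" if "y \<in> succs x" for y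
      using that by (simp add: freeze_def depth_succ Suc_diff_le parent_succ funpow_Suc_right del: funpow.simps(2))
    then have "(\<Sum>y\<in>succs x. smul (of_real (q x y)) (freeze m \<phi> y)) =
        smul (of_real (\<Sum>y\<in>succs x. q x y)) (freeze m \<phi> x)"
      by (simp add: scale_sum_left)
    then show ?thesis by (simp add: q_sum)
  qed
  then show ?thesis by (intro harmonicI) (rule sym)
qed

lemma freeze_harmonic: "f \<in> harmonic_functions smul \<Longrightarrow> depth x \<le> m \<Longrightarrow> freeze m f x = f x"
  by (simp add: freeze_def avg_harmonic)

lemma freeze_boundary: "e \<in> boundary \<Longrightarrow> m \<le> n \<Longrightarrow> freeze m \<phi> (e n) = \<phi> (e m)"
  using parent_funpow_boundary[of e "n - m" m] by (simp add: freeze_def)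

text \<open>Every value of \<open>freeze m \<phi>\<close> arises from values of
  \<open>\<phi>\<close> by finitely many scalings and sums.\<close>

lemma continuous_on_freeze: "continuous_on UNIV (freeze m)"
proof -
  have "continuous_on UNIV (\<lambda>\<phi>. avg k \<phi> x)" for k x
  proof (induction k arbitrary: x)
    case (Suc k)
    show ?case
      unfolding avg.simps
      by (intro continuous_on_sum' continuous_on_compose2[OF continuous_on_smul Suc]) auto
  qed (simp add: continuous_on_product_coordinates)
  then have "continuous_on UNIV (\<lambda>\<phi>. freeze m \<phi> x)" for x
    unfolding freeze_def by blast
  then show ?thesis by (rule continuous_on_coordinatewise_then_product)
qed

text \<open>The difference to the current target \<open>G n\<close> is moved onto the light successor.  A path along
  which the target does not change therefore attains the target as soon as it leaves the light
  successors.\<close>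

primrec steer_aux :: "(nat \<Rightarrow> 'v \<Rightarrow> 'e) \<Rightarrow> nat \<Rightarrow> 'v \<Rightarrow> 'e" where
  "steer_aux G 0 x = G 0 x"
| "steer_aux G (Suc n) x = G (Suc n) x + (if x = light (parent x)
     then smul (of_real (1 / q (parent x) x)) (steer_aux G n (parent x) - G (Suc n) (parent x)) else 0)"

definition steer :: "(nat \<Rightarrow> 'v \<Rightarrow> 'e) \<Rightarrow> 'v \<Rightarrow> 'e" where
  "steer G x = steer_aux G (depth x) x"

lemma steer_root: "steer G x0 = G 0 x0"
  by (simp add: steer_def)

lemma steer_succ:
  assumes "y \<in> succs x"
  shows "steer G y = G (Suc (depth x)) y +
    (if y = light x then smul (of_real (1 / q x y)) (steer G x - G (Suc (depth x)) x) else 0)"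
  unfolding steer_def depth_succ[OF assms] steer_aux.simps parent_succ[OF assms] by (rule refl)

text \<open>The factor \<open>1 / q\<close> cancels the weight of the light successor, so averaging
  adds exactly the missing difference to the value of the target.\<close>

lemma harmonic_steer:
  assumes "\<And>n. G n \<in> harmonic_functions smul"
  shows "steer G \<in> harmonic_functions smul"
proof -
  have "steer G x = (\<Sum>y\<in>succs x. smul (of_real (q x y)) (steer G y))" for x
  proof -
    let ?H = "G (Suc (depth x))"
    have "smul (of_real (q x y)) (steer G y) = smul (of_real (q x y)) (?H y) +
        (if y = light x then steer G x - ?H x else 0)" if y: "y \<in> succs x" for y
    proof -
      have "smul (of_real (q x y)) (smul (of_real (1 / q x y)) z) = z" for z
        using q_pos[OF y] by simp
      then show ?thesis
        unfolding steer_succ[OF y] scale_right_distrib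
        by (simp only: if_distrib[of "smul _"] scale_zero_right)
    qed
    then have "(\<Sum>y\<in>succs x. smul (of_real (q x y)) (steer G y)) =
        (\<Sum>y\<in>succs x. smul (of_real (q x y)) (?H y)) +
        (\<Sum>y\<in>succs x. if y = light x then steer G x - ?H x else 0)"
      by (simp add: sum.distrib)
    also have "\<dots> = ?H x + (steer G x - ?H x)"
      using light_succ by (simp add: harmonicD[OF assms] finite_succs)
    finally show ?thesis by simp
  qed
  then show ?thesis by (intro harmonicI) (rule sym)
qed

text \<open>While the target stays the same from the root on, there is no difference to
  compensate.\<close>

lemma steer_initial:
  assumes "\<And>n. n \<le> a \<Longrightarrow> G n = g"
  shows "depth x \<le> a \<Longrightarrow> steer G x = g x"
  by (induction x rule: vertex_induct) (auto simp: steer_root steer_succ depth_succ assms)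

lemma steer_off_light_run:
  assumes e: "e \<in> boundary" "e \<notin> light_run n k"
    and G: "\<And>i. n < i \<Longrightarrow> i \<le> n + k \<Longrightarrow> G i = g"
  shows "steer G (e (n + k)) = g (e (n + k))"
proof -
  obtain i where i: "i < k" "e (n + Suc i) \<noteq> light (e (n + i))"
    using e by (auto simp: light_run_def)
  have succ: "steer G (e (n + Suc j)) = g (e (n + Suc j)) + (if e (n + Suc j) = light (e (n + j))
      then smul (of_real (1 / q (e (n + j)) (e (n + Suc j)))) (steer G (e (n + j)) - g (e (n + j))) else 0)"
    if "j < k" for j
    using steer_succ[OF boundaryD(2)[OF e(1)], of G "n + j"] G[of "n + Suc j"] that
    by (simp only: depth_boundary[OF e(1)] add_Suc_right)
  \<comment> \<open>After a step that avoids the light successor the difference is zero, and it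
    stays zero while the target remains \<open>g\<close>.\<close>
  have "Suc i + j \<le> k \<Longrightarrow> steer G (e (n + (Suc i + j))) = g (e (n + (Suc i + j)))" for j
  proof (induction j)
    case 0
    then show ?case using succ[OF i(1)] i(2) by simp
  next
    case (Suc j)
    then show ?case using succ[of "Suc i + j"] by simp
  qed
  from this[of "k - Suc i"] show ?thesis using i(1) by simp
qed

text \<open>The targets. A code consists of the freezing level and a finitely supported function, so
  there are countably many codes.\<close>

definition simple :: "nat \<times> ('v \<times> nat) list \<Rightarrow> 'v \<Rightarrow> 'e" where
  "simple c = freeze (fst c) (finite_support_fun (snd c))"

text \<open>The discarded component of the decoded pair makes every value occur infinitely often.\<close>

definition schedule ::
  "nat \<Rightarrow> (nat \<times> nat \<times> ('v \<times> nat) list) \<times> nat \<times> ('v \<times> nat) list" where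
  "schedule j = from_nat (fst (prod_decode j))"

lemma schedule_surj: "\<exists>j\<ge>i. schedule j = s"
  by (rule exI[of _ "prod_encode (to_nat s, i)"]) (simp add: schedule_def le_prod_encode_2)

text \<open>Past all initial levels \<open>fst l\<close>, only one generator at a time has a nonzero target.  A linear
  combination then approximates the target of any generator that occurs in it, up to a factor.\<close>

definition target :: "nat \<times> nat \<times> ('v \<times> nat) list \<Rightarrow> nat \<Rightarrow> 'v \<Rightarrow> 'e" where
  "target l n = (if n \<le> fst l then simple (snd l)
     else if fst (schedule (ruler (phase n))) = l then simple (snd (schedule (ruler (phase n))))
     else (\<lambda>_. 0))"

text \<open>The label \<open>l\<close> consists of the last initial level and the code of the simple
  function followed up to there; these initial values make the generators dense.\<close>

definition generator :: "nat \<times> nat \<times> ('v \<times> nat) list \<Rightarrow> 'v \<Rightarrow> 'e" where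
  "generator l = steer (target l)"

lemma harmonic_generator: "generator l \<in> harmonic_functions smul"
  unfolding generator_def
  by (rule harmonic_steer) (auto simp: target_def simple_def harmonic_freeze, rule harmonicI, simp)

lemma generator_initial: "depth x \<le> fst l \<Longrightarrow> generator l x = simple (snd l) x"
  unfolding generator_def by (rule steer_initial[of "fst l"]) (auto simp: target_def)

text \<open>Once its initial levels are over, a generator has one and the same target throughout the
  block that ends at \<open>hit (Suc i)\<close>, so it attains it off the light run.\<close>

lemma generator_hit:
  assumes "e \<in> boundary" "e \<notin> light_run (hit i) (Suc (ruler (Suc i)))" "fst l \<le> hit i"
    and "schedule (ruler (Suc i)) = (k, c)"
  shows "generator l (e (hit (Suc i))) = (if l = k then simple c (e (hit (Suc i))) else 0)"
proof -
  have "target l n = (if l = k then simple c else (\<lambda>_. 0))"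
    if "hit i < n" "n \<le> hit i + Suc (ruler (Suc i))" for n
    using that assms(3,4) phase_eq[of i n] by (auto simp: target_def hit_Suc)
  from steer_off_light_run[OF assms(1,2) this] show ?thesis
    by (simp add: generator_def hit_Suc)
qed

section \<open>Linear combinations of generators\<close>

definition combination ::
  "(nat \<times> nat \<times> ('v \<times> nat) list \<Rightarrow> 'k) \<Rightarrow> (nat \<times> nat \<times> ('v \<times> nat) list) set \<Rightarrow> 'v \<Rightarrow> 'e" where
  "combination c A x = (\<Sum>l\<in>A. smul (c l) (generator l x))"

lemma harmonic_combination: "combination c A \<in> harmonic_functions smul"
proof -
  have "(\<Sum>y\<in>succs x. smul (of_real (q x y)) (combination c A y)) = combination c A x" for x
  proof -
    have "(\<Sum>y\<in>succs x. smul (of_real (q x y)) (combination c A y)) =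
        (\<Sum>y\<in>succs x. \<Sum>l\<in>A. smul (c l) (smul (of_real (q x y)) (generator l y)))"
      by (simp add: combination_def scale_sum_right mult.commute)
    also have "\<dots> = (\<Sum>l\<in>A. smul (c l) (\<Sum>y\<in>succs x. smul (of_real (q x y)) (generator l y)))"
      by (subst sum.swap) (simp add: scale_sum_right)
    also have "\<dots> = combination c A x"
      by (simp add: combination_def harmonicD[OF harmonic_generator])
    finally show ?thesis .
  qed
  then show ?thesis by (rule harmonicI)
qed

text \<open>Scaling by \<open>c\<close> is continuous and attains \<open>x\<close> at
  \<open>smul (inverse c) x\<close>, so the preimage of a ball around \<open>x\<close> is open and
  nonempty.\<close>

lemma dense_seq_scaled:
  assumes "c \<noteq> 0" "\<delta> > 0"
  shows "\<exists>i. dist x (smul c (dense_seq i)) < \<delta>"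
proof -
  have "open {y. dist x (smul c y) < \<delta>}"
    using continuous_on_smul by (intro open_Collect_less continuous_intros) auto
  moreover have "smul (inverse c) x \<in> {y. dist x (smul c y) < \<delta>}"
    using assms by simp
  ultimately show ?thesis using dense_seq by blast
qed

text \<open>Up to small probability, \<open>g\<close> is close to \<open>c k\<close> times the
  boundary values of a simple function. After the initial levels, the generator \<open>k\<close> has
  that function as its target in all blocks of some high rank \<open>j\<close>, where the other
  generators have target 0; the hitting times of rank \<open>j\<close> have positive lower
  density.\<close>

lemma freq_universal_combination:
  assumes "finite A" "k \<in> A" "c k \<noteq> 0"
  shows "combination c A \<in> freq_universal smul"
proof -
  have "lower_density {n. ae_class boundary_measure (\<omega> n (combination c A)) \<in> V} > 0"
    if V: "openin (L0_topology boundary_measure) V" "V \<noteq> {}" for V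
  proof -
    obtain g \<epsilon> where g: "g \<in> borel_measurable boundary_measure" "\<epsilon> > 0"
      and gV: "\<And>h. h \<in> borel_measurable boundary_measure \<Longrightarrow> prob_dist boundary_measure g h < \<epsilon> \<Longrightarrow>
        ae_class boundary_measure h \<in> V"
      using boundary.open_L0E[OF V] by blast
    \<comment> \<open>Three errors of \<open>\<epsilon> / 4\<close> arise: the distance off the
      exceptional sets, the set \<open>B\<close> and the light run.\<close>
    have e4: "\<epsilon> / 4 > 0" using g(2) by simp
    \<comment> \<open>The approximating values are scaled by \<open>c k\<close>, the factor with
      which the generator \<open>k\<close> enters the combination.\<close>
    obtain m B \<phi> where B: "B \<in> sets boundary_measure" "boundary.prob B < \<epsilon> / 4"
      "\<And>e. e \<in> boundary \<Longrightarrow> e \<notin> B \<Longrightarrow> dist (g e) (smul (c k) (dense_seq (\<phi> (e m)))) < \<epsilon> / 4"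
      by (rule approx_by_step_function[OF g(1) _ e4, of "\<lambda>i. smul (c k) (dense_seq i)"])
        (use dense_seq_scaled[OF assms(3)] in auto)
    obtain L where L: "\<And>x. x \<in> level m \<Longrightarrow> finite_support_fun L x = (dense_seq (\<phi> x) :: 'e)"
      using finite_support_fun_exists[OF finite_level] by metis
    obtain i0 where i0: "(1 / 2) ^ i0 < \<epsilon> / 4"
      using real_arch_pow_inv[OF e4, of "1 / 2"] by auto
    \<comment> \<open>A rank of at least \<open>i0\<close> makes the blocks long enough for the
      light run to be unlikely.\<close>
    obtain j where j: "j \<ge> i0" "schedule j = (k, (m, L))" using schedule_surj by blast
    have half: "(1 / 2) ^ Suc j < \<epsilon> / 4"
    proof -
      have "(1 / 2 :: real) ^ Suc j \<le> (1 / 2) ^ i0" using j(1) by (intro power_decreasing) auto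
      then show ?thesis using i0 by linarith
    qed
    \<comment> \<open>By \<open>ruler_pow2\<close>, these block indices have rank \<open>j\<close>;
      they grow linearly in \<open>r\<close>.\<close>
    let ?s = "\<lambda>r. hit (2 ^ j * Suc (2 * r))"
    show ?thesis
    proof (rule lower_density_pos)
      show "inj ?s"
        by (rule injI) (simp add: strict_mono_eq[OF strict_mono_hit])
      show "(2 :: nat) ^ (j + 2) > 0" by simp
      show "?s r \<le> 2 ^ (j + 2) * Suc r" for r
        using hit_le[of "2 ^ j * Suc (2 * r)"] by (simp add: power_add algebra_simps)
      \<comment> \<open>From here on, level \<open>m\<close> has been reached and the initial levels
        of all generators in \<open>A\<close> are over.\<close>
      fix r assume r: "r \<ge> m + (\<Sum>l\<in>A. fst l)"
      have "2 ^ j * Suc (2 * r) > 0" by simp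
      then obtain i where i: "2 ^ j * Suc (2 * r) = Suc i" using gr0_implies_Suc by blast
      have "1 * Suc (2 * r) \<le> 2 ^ j * Suc (2 * r)" by (rule mult_le_mono1) simp
      then have "r \<le> i" unfolding i by simp
      then have "r \<le> hit i" using strict_mono_imp_increasing[OF strict_mono_hit, of i] by linarith
      have le: "m \<le> hit (Suc i)" "\<And>l. l \<in> A \<Longrightarrow> fst l \<le> hit i"
      proof -
        show "m \<le> hit (Suc i)" using r \<open>r \<le> hit i\<close> by (simp add: hit_Suc)
        fix l assume "l \<in> A"
        then have "fst l \<le> (\<Sum>l\<in>A. fst l)" using assms(1) by (intro member_le_sum) auto
        then show "fst l \<le> hit i" using r \<open>r \<le> hit i\<close> by linarith
      qed
      have ruler: "ruler (Suc i) = j" using ruler_pow2[of j r] i by simp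
      let ?R = "light_run (hit i) (Suc j)" and ?n = "hit (Suc i)"
      have val: "combination c A (e ?n) = smul (c k) (dense_seq (\<phi> (e m)))"
        if e: "e \<in> boundary" "e \<notin> ?R" for e
      proof -
        have "combination c A (e ?n) =
            (\<Sum>l\<in>A. smul (c l) (if l = k then simple (m, L) (e ?n) else 0))"
          unfolding combination_def
          using generator_hit[of e i _ k "(m, L)"] e le(2) j(2) ruler by (intro sum.cong) auto
        also have "\<dots> = (\<Sum>l\<in>A. if l = k then smul (c k) (simple (m, L) (e ?n)) else 0)"
          by (intro sum.cong) auto
        also have "\<dots> = smul (c k) (simple (m, L) (e ?n))"
          using assms(1,2) by simp
        also have "simple (m, L) (e ?n) = dense_seq (\<phi> (e m))"
          using freeze_boundary[OF e(1) le(1)] L[of "e m"] e(1) by (simp add: simple_def level_def)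
        finally show ?thesis .
      qed
      have "prob_dist boundary_measure g (\<omega> ?n (combination c A)) \<le> \<epsilon> / 4 + boundary.prob (B \<union> ?R)"
      proof (rule boundary.prob_dist_le)
        show "\<omega> ?n (combination c A) \<in> borel_measurable boundary_measure"
          unfolding \<omega>_def by (rule measurable_vertex_fun)
        fix e assume "e \<in> space boundary_measure" "e \<notin> B \<union> ?R"
        then show "dist (g e) (\<omega> ?n (combination c A) e) \<le> \<epsilon> / 4"
          using val B(3) by (simp add: \<omega>_def space_boundary_measure less_imp_le)
      qed (use g B light_run_in_sets in auto)
      also have "boundary.prob (B \<union> ?R) \<le> boundary.prob B + boundary.prob ?R"
        by (rule measure_Un_le) (use B light_run_in_sets in auto)
      also have "boundary.prob ?R < \<epsilon> / 4"
        using prob_light_run[of "hit i" "Suc j"] half by linarith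
      finally have "prob_dist boundary_measure g (\<omega> ?n (combination c A)) < \<epsilon>"
        using B(2) g(2) by linarith
      then have "ae_class boundary_measure (\<omega> ?n (combination c A)) \<in> V"
        by (intro gV) (simp_all add: \<omega>_def measurable_vertex_fun)
      then show "?s r \<in> {n. ae_class boundary_measure (\<omega> n (combination c A)) \<in> V}"
        by (simp only: i mem_Collect_eq)
    qed
  qed
  then show ?thesis using harmonic_combination by (simp add: freq_universal_def)
qed

text \<open>A basic neighborhood constrains \<open>f\<close> only up to some level \<open>m\<close>,
  where freezing does not change \<open>f\<close>. By continuity of freezing, some coded finitely
  supported function still meets the constraints after freezing, and it serves as the initial target
  of a generator.\<close>

lemma generator_dense:
  assumes "f \<in> harmonic_functions smul" "open U" "f \<in> U"
  shows "\<exists>l. generator l \<in> U"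
proof -
  obtain X where X: "\<And>x. open (X x)" "\<And>x. f x \<in> X x" "finite {x. X x \<noteq> UNIV}"
    "\<And>g. (\<And>x. g x \<in> X x) \<Longrightarrow> g \<in> U"
    using open_fun_basis[OF assms(2,3)] by metis
  define m where "m = (\<Sum>x | X x \<noteq> UNIV. depth x)"
  have m: "depth x \<le> m" if "X x \<noteq> UNIV" for x
    unfolding m_def using X(3) that by (intro member_le_sum) auto
  \<comment> \<open>Only the constrained coordinates are kept, as a generator is known to agree with
    its initial target up to level \<open>m\<close> only.\<close>
  define O' where "O' = {g. \<forall>x\<in>{x. X x \<noteq> UNIV}. g x \<in> X x}"
  have "open O'"
  proof -
    have "O' = (\<Inter>x\<in>{x. X x \<noteq> UNIV}. (\<lambda>g. g x) -` X x)" by (auto simp: O'_def)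
    moreover have "open ((\<lambda>g :: 'v \<Rightarrow> 'e. g x) -` X x)" for x
      using X(1) continuous_on_product_coordinates by (intro open_vimage) auto
    ultimately show ?thesis using X(3) by auto
  qed
  then have "open (freeze m -` O')" using continuous_on_freeze by (rule open_vimage)
  moreover have "f \<in> freeze m -` O'"
    using X(2) m by (auto simp: O'_def freeze_harmonic[OF assms(1)])
  ultimately obtain L where L: "finite_support_fun L \<in> freeze m -` O'"
    using finite_support_fun_dense by blast
  \<comment> \<open>The first \<open>m\<close> is the last initial level, the second one the
    freezing level.\<close>
  have "generator (m, m, L) x \<in> X x" for x
  proof (cases "X x = UNIV")
    case False
    then show ?thesis using L m generator_initial[of x "(m, m, L)"] by (auto simp: O'_def simple_def)
  qed simp
  then show ?thesis using X(4) by blast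
qed

section \<open>The subspace and its density\<close>

lemma module_fun: "module (\<lambda>c (f :: 'v \<Rightarrow> 'e) x. smul c (f x))"
  by unfold_locales (auto simp: fun_eq_iff scale_right_distrib scale_left_distrib)

lemma subspace_combinations:
  "module.subspace (\<lambda>c f x. smul c (f x)) {combination c A | c A. finite A}"
  unfolding module.subspace_def[OF module_fun]
proof (intro conjI ballI allI)
  have "0 = combination (\<lambda>_. 0) {}" by (auto simp: combination_def fun_eq_iff)
  then show "0 \<in> {combination c A | c A. finite A}" by blast
next
  fix f g assume "f \<in> {combination c A | c A. finite A}" "g \<in> {combination c A | c A. finite A}"
  then obtain c A d B where *: "f = combination c A" "finite A" "g = combination d B" "finite B"
    by blast
  \<comment> \<open>Both coefficient families are extended by 0 to the union of the index
    sets.\<close>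
  define c' where "c' l = (if l \<in> A then c l else 0) + (if l \<in> B then d l else 0)" for l
  have "(\<Sum>l\<in>A \<union> B. smul (if l \<in> A then c l else 0) (generator l x)) = f x"
    "(\<Sum>l\<in>A \<union> B. smul (if l \<in> B then d l else 0) (generator l x)) = g x" for x
    unfolding * combination_def using *(2,4) by (intro sum.mono_neutral_cong_right; auto)+
  then have "f + g = combination c' (A \<union> B)"
    by (auto simp: fun_eq_iff combination_def c'_def scale_left_distrib sum.distrib)
  then show "f + g \<in> {combination c A | c A. finite A}" using *(2,4) by blast
next
  fix b f assume "f \<in> {combination c A | c A. finite A}"
  then obtain c A where *: "f = combination c A" "finite A" by blast
  have "(\<lambda>x. smul b (f x)) = combination (\<lambda>l. b * c l) A"
    by (simp add: * combination_def fun_eq_iff scale_sum_right)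
  then show "(\<lambda>x. smul b (f x)) \<in> {combination c A | c A. finite A}" using *(2) by blast
qed

text \<open>A nonzero coefficient on \<open>A\<close> makes its generator available for
  universality; without one, the combination is the zero function.\<close>

lemma combination_universal_or_zero:
  assumes "finite A"
  shows "combination c A \<in> freq_universal smul \<union> {0}"
proof (cases "\<exists>k\<in>A. c k \<noteq> 0")
  case True
  then show ?thesis using freq_universal_combination[OF assms] by blast
next
  case False
  then have "combination c A = 0" by (auto simp: combination_def fun_eq_iff)
  then show ?thesis by blast
qed

text \<open>Single generators are combinations, and they already meet every open set that contains a
  harmonic function.\<close>

lemma closure_of_combinations:
  "(top_of_set (harmonic_functions smul)) closure_of {combination c A | c A. finite A} =
    harmonic_functions smul" (is "?X closure_of ?W = ?H")
proof
  show "?X closure_of ?W \<subseteq> ?H" using closure_of_subset_topspace[of ?X ?W] by simp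
  show "?H \<subseteq> ?X closure_of ?W"
  proof
    fix f assume f: "f \<in> ?H"
    have "\<exists>g. g \<in> ?W \<and> g \<in> T" if T: "f \<in> T" "openin ?X T" for T
    proof -
      obtain U where U: "open U" "T = ?H \<inter> U" using T(2) by (auto simp: openin_open)
      obtain l where l: "generator l \<in> U" using generator_dense[OF f U(1)] U(2) T(1) by blast
      have "generator l = combination (\<lambda>_. 1) {l}" by (simp add: combination_def fun_eq_iff)
      then have "generator l \<in> ?W" by blast
      then show ?thesis using l U(2) harmonic_generator by blast
    qed
    then show "f \<in> ?X closure_of ?W" using f by (auto simp: in_closure_of)
  qed
qed

end

theorem theorem4p3:
  fixes adj :: "'v::countable \<Rightarrow> 'v \<Rightarrow> bool" and x0 :: 'v and q :: "'v \<Rightarrow> 'v \<Rightarrow> real"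
    and smul :: "'k::{real_normed_field,heine_borel} \<Rightarrow> 'e::{ab_group_add,polish_space} \<Rightarrow> 'e"
  assumes "weighted_tree adj x0 q"
    and "separable_frechet_space smul"
  shows "\<exists>W. module.subspace (\<lambda>c f x. smul c (f x)) W \<and>
    W \<subseteq> weighted_tree.harmonic_functions adj x0 q smul \<and>
    W \<subseteq> weighted_tree.freq_universal adj x0 q smul \<union> {0} \<and>
    (top_of_set (weighted_tree.harmonic_functions adj x0 q smul)) closure_of W =
      weighted_tree.harmonic_functions adj x0 q smul"
proof -
  interpret frechet_tree adj x0 q smul
    using assms by (simp add: frechet_tree_def)
  show ?thesis
    using subspace_combinations closure_of_combinations harmonic_combination
      combination_universal_or_zero
    by (intro exI[of _ "{combination c A | c A. finite A}"]) blast
qed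

end
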